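(* Let $P_1,\dots,P_n$ and $Q_1,\dots,Q_n$ be convex polytopes in $\mathbb R^n$ such that $P_i\subseteq Q_i$ for every $i\in\{1,\dots,n\}$. For a non-zero vector $u\in\mathbb R^n$ let $B_{i,u}=\{x\in Q_i\mid \langle u,x\rangle\ge h_{P_i}(u)\}$ for $1\le i\le n$. The following are equivalent: (1) $V(P_1,\dots,P_n)<V(Q_1,\dots,Q_n)$; (2) there exists a fully mixed $(2n-1)$-dimensional simplex $\mathcal C(E_1,\dots,E_n)$ contained in the relative closure of $\mathcal C(Q_1,\dots,Q_n)\setminus\mathcal C(P_1,\dots,P_n)$; (3) there exists a non-zero vector $u\in\mathbb R^n$ such that the collection $\{B_{1,u},\dots,B_{n,u}\}$ is essential.
   Context: $V(\cdot)$ is the mixed volume of $n$ convex bodies in $\mathbb R^n$ and $h_K(u)=\max\{\langle u,x\rangle\mid x\in K\}$ is the support function. A collection $\{K_1,\dots,K_m\}$ of convex bodies in $\mathbb R^n$ is essential if $\dim\sum_{i\in I}K_i\ge|I|$ for every $I\subseteq\{1,\dots,m\}$ with $|I|\le n$. For polytopes $P_1,\dots,P_k\subset\mathbb R^n$, the Cayley polytope $\mathcal C(P_1,\dots,P_k)$ is the convex hull in $\mathbb R^n\times\mathbb R^k$ of $\bigcup_{i=1}^k P_i\times\{e_i\}$, where $e_1,\dots,e_k$ is the standard basis of $\mathbb R^k$; it is called fully mixed if $\dim P_i\ge1$ for all $i$. Thus $\mathcal C(E_1,\dots,E_n)$ in (2) is the Cayley polytope of polytopes $E_1,\dots,E_n\subset\mathbb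 R^n$ (necessarily $E_i\subseteq Q_i$ as it lies in $\mathcal C(Q_1,\dots,Q_n)$). The relative closure is the closure taken within the affine span of $\mathcal C(Q_1,\dots,Q_n)$. *)

theory Defs
  imports "HOL-Analysis.Analysis" "HOL-Library.Set_Algebras"
begin

definition msum :: "('i \<Rightarrow> 'a::comm_monoid_add set) \<Rightarrow> 'i set \<Rightarrow> 'a set" where
  "msum K I = {\<Sum>i\<in>I. f i | f. \<forall>i\<in>I. f i \<in> K i}"

definition supp_fun :: "'a::euclidean_space set \<Rightarrow> 'a \<Rightarrow> real" where
  "supp_fun K u = Sup ((\<lambda>x. inner u x) ` K)"

text \<open>Mixed volume of n convex bodies K_i (i ranging over the n-element index type 'n)
  in R^n, via the polarization formula
  V(K_1,...,K_n) = 1/n! * sum over nonempty I of (-1)^(n-|I|) vol(sum_{i in I} K_i).\<close>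
definition mixed_volume :: "('n::finite \<Rightarrow> (real^'n) set) \<Rightarrow> real" where
  "mixed_volume K = (1 / fact CARD('n)) *
     (\<Sum>I\<in>{I. I \<subseteq> (UNIV::'n set) \<and> I \<noteq> {}}.
        (-1) ^ (CARD('n) - card I) * measure lebesgue (msum K I))"

definition essential :: "('i::finite \<Rightarrow> (real^'n::finite) set) \<Rightarrow> bool" where
  "essential K \<longleftrightarrow> (\<forall>I. card I \<le> CARD('n) \<longrightarrow> aff_dim (msum K I) \<ge> int (card I))"

definition cayley :: "('k::finite \<Rightarrow> (real^'n::finite) set) \<Rightarrow> ((real^'n) \<times> (real^'k)) set" where
  "cayley P = convex hull (\<Union>i. (\<lambda>x. (x, axis i 1)) ` P i)"

definition fully_mixed :: "('k::finite \<Rightarrow> (real^'n::finite) set) \<Rightarrow> bool" where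
  "fully_mixed P \<longleftrightarrow> (\<forall>i. aff_dim (P i) \<ge> 1)"

definition rel_closure_in :: "'a::euclidean_space set \<Rightarrow> 'a set \<Rightarrow> 'a set" where
  "rel_closure_in A S = (top_of_set (affine hull A)) closure_of S"

end

theory Submission
  imports Defs
begin

text \<open>
  A lifting of finite configurations \<open>A i\<close> spanning the polytopes subdivides every partial Minkowski
  sum coherently, and inclusion-exclusion turns this into additivity:
  \<open>V(conv A 1, \<dots>, conv A n)\<close> is the sum of the mixed volumes of the cells, over finitely many
  slopes \<open>x\<close>. Refining until the Cayley vectors \<open>(a, e i)\<close> of a cell are linearly independent
  leaves cells of mixed volume zero and sums of segments with independent directions; hence mixed
  volumes are nonnegative, and positive exactly if there are such segments.

  Lifting the points of \<open>P\<close> to height \<open>0\<close> and the other vertices of \<open>Q\<close> to \<open>-1\<close> makes \<open>P\<close> the cell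
  of slope \<open>0\<close>, while the cell of a slope \<open>u \<noteq> 0\<close> lies in the caps \<open>B u i\<close>. Lifting by
  \<open>- max 0 (u \<bullet> a - h i)\<close>, with \<open>h i\<close> the support function of \<open>P i\<close> at \<open>u\<close>, gives
  \<open>V(Q) \<ge> V(P) + V(B u)\<close>. So strict inequality means that some family of caps contains segments
  with independent directions, which by Rado's theorem is essentiality. Such segments span a fully
  mixed Cayley simplex on the outer side of the hyperplane given by \<open>u\<close> and \<open>h\<close>; conversely,
  separating such a simplex from the Cayley polytope of \<open>P\<close> yields \<open>u\<close>.
\<close>

section \<open>Coherent subdivisions\<close>

text \<open>The cells of the coherent subdivision of the configuration \<open>p\<close> induced by the lifting \<open>w\<close>,
  indexed by the slopes \<open>x\<close> of the affine functions supporting the lifted configuration.\<close>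
definition max_cell :: "('t \<Rightarrow> 'a::euclidean_space) \<Rightarrow> ('t \<Rightarrow> real) \<Rightarrow> 't set \<Rightarrow> 'a \<Rightarrow> 't set" where
  "max_cell p w T x = {t \<in> T. \<forall>s\<in>T. x \<bullet> p s + w s \<le> x \<bullet> p t + w t}"

lemma max_cell_subset: "max_cell p w T x \<subseteq> T"
  by (auto simp: max_cell_def)

lemma max_cell_nonempty:
  assumes "finite T" "T \<noteq> {}"
  shows "max_cell p w T x \<noteq> {}"
proof -
  define g where "g t = x \<bullet> p t + w t" for t
  have "Max (g ` T) \<in> g ` T"
    using assms by (intro Max_in) auto
  then obtain t where t: "t \<in> T" "g t = Max (g ` T)"
    by auto
  then have "\<forall>s\<in>T. g s \<le> g t"
    using assms by auto
  with t show ?thesis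
    by (auto simp: max_cell_def g_def)
qed

lemma lift_convex_hull:
  assumes "y \<in> convex hull (p ` C)"
  obtains r where "(y, r) \<in> convex hull ((\<lambda>t. (p t, w t)) ` C)"
proof -
  have "fst ` (convex hull ((\<lambda>t. (p t, w t)) ` C)) = convex hull (p ` C)"
    by (subst convex_hull_linear_image) (auto simp: linear_fst image_image)
  with assms have "y \<in> fst ` (convex hull ((\<lambda>t. (p t, w t)) ` C))"
    by simp
  then show ?thesis
    using that by (auto simp del: split_paired_All)
qed

lemma lift_convex_hull_le:
  assumes "(y, r) \<in> convex hull ((\<lambda>t. (p t, w t)) ` C)" "\<And>t. t \<in> C \<Longrightarrow> x \<bullet> p t + w t \<le> m"
  shows "x \<bullet> y + r \<le> m"
proof -
  have "(\<lambda>t. (p t, w t)) ` C \<subseteq> {z. (x, 1) \<bullet> z \<le> m}"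
    using assms(2) by (auto simp: inner_prod_def)
  then have "convex hull ((\<lambda>t. (p t, w t)) ` C) \<subseteq> {z. (x, 1) \<bullet> z \<le> m}"
    by (intro hull_minimal convex_halfspace_le)
  with assms(1) show ?thesis
    by (auto simp: inner_prod_def)
qed

lemma lift_convex_hull_ge:
  assumes "(y, r) \<in> convex hull ((\<lambda>t. (p t, w t)) ` C)" "\<And>t. t \<in> C \<Longrightarrow> m \<le> x \<bullet> p t + w t"
  shows "m \<le> x \<bullet> y + r"
proof -
  have "(\<lambda>t. (p t, w t)) ` C \<subseteq> {z. (x, 1) \<bullet> z \<ge> m}"
    using assms(2) by (auto simp: inner_prod_def)
  then have "convex hull ((\<lambda>t. (p t, w t)) ` C) \<subseteq> {z. (x, 1) \<bullet> z \<ge> m}"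
    by (intro hull_minimal convex_halfspace_ge)
  with assms(1) show ?thesis
    by (auto simp: inner_prod_def)
qed

text \<open>Over a cell of slope \<open>x\<close> the functional \<open>(x, 1)\<close> is constant
  at its maximum. Comparing the two lifts of \<open>y\<close> through both functionals forces their
  heights to agree, and subtracting the equations eliminates the height.\<close>

lemma max_cells_Int_hyperplane:
  assumes y: "y \<in> convex hull (p ` max_cell p w T x)" "y \<in> convex hull (p ` max_cell p w T x')"
    and t: "t \<in> max_cell p w T x" "t' \<in> max_cell p w T x'"
  shows "(x - x') \<bullet> y = (x \<bullet> p t + w t) - (x' \<bullet> p t' + w t')"
proof -
  obtain r where r: "(y, r) \<in> convex hull ((\<lambda>t. (p t, w t)) ` max_cell p w T x)"
    using y(1) by (rule lift_convex_hull)
  obtain r' where r': "(y, r') \<in> convex hull ((\<lambda>t. (p t, w t)) ` max_cell p w T x')"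
    using y(2) by (rule lift_convex_hull)
  have "x \<bullet> y + r \<ge> x \<bullet> p t + w t" "x' \<bullet> y + r \<le> x' \<bullet> p t' + w t'"
    using t by (auto intro!: lift_convex_hull_ge[OF r] lift_convex_hull_le[OF r] simp: max_cell_def)
  moreover have "x' \<bullet> y + r' \<ge> x' \<bullet> p t' + w t'" "x \<bullet> y + r' \<le> x \<bullet> p t + w t"
    using t by (auto intro!: lift_convex_hull_ge[OF r'] lift_convex_hull_le[OF r'] simp: max_cell_def)
  moreover have "x \<bullet> y + r \<le> x \<bullet> p t + w t" "x' \<bullet> y + r' \<le> x' \<bullet> p t' + w t'"
    using t by (auto intro!: lift_convex_hull_le[OF r] lift_convex_hull_le[OF r'] simp: max_cell_def)
  ultimately show ?thesis
    by (simp add: inner_diff_left)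
qed

lemma negligible_max_cells_Int:
  assumes "x \<noteq> x'"
  shows "negligible (convex hull (p ` max_cell p w T x) \<inter> convex hull (p ` max_cell p w T x'))"
proof (cases "max_cell p w T x = {} \<or> max_cell p w T x' = {}")
  case False
  then obtain t t' where "t \<in> max_cell p w T x" "t' \<in> max_cell p w T x'"
    by blast
  then have "convex hull (p ` max_cell p w T x) \<inter> convex hull (p ` max_cell p w T x')
      \<subseteq> {y. (x - x') \<bullet> y = (x \<bullet> p t + w t) - (x' \<bullet> p t' + w t')}"
    by (auto intro: max_cells_Int_hyperplane)
  then show ?thesis
    using assms by (intro negligible_subset[OF negligible_hyperplane]) auto
qed auto

lemma interior_subset_Union_max_cells:
  fixes p :: "'t \<Rightarrow> 'a::euclidean_space"
  assumes T: "finite T" and y: "y \<in> interior (convex hull (p ` T))"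
  shows "\<exists>x. y \<in> convex hull (p ` max_cell p w T x)"
proof -
  define S where "S = (\<lambda>t. (p t, w t)) ` T"
  define G where "G = convex hull S"
  have G: "compact G" "convex G"
    using T by (auto simp: G_def S_def finite_imp_compact_convex_hull)
  define R where "R = {r. (y, r) \<in> G}"
  have "R = snd ` (G \<inter> {z. fst z = y})"
    by (force simp: R_def)
  moreover have "closed {z :: 'a \<times> real. fst z = y}"
    by (intro closed_Collect_eq continuous_intros)
  ultimately have "compact R"
    using G by (auto intro!: compact_continuous_image continuous_intros compact_Int_closed)
  moreover obtain r0 where "(y, r0) \<in> convex hull ((\<lambda>t. (p t, w t)) ` T)"
    using interior_subset[THEN subsetD, OF y] by (rule lift_convex_hull)
  then have "R \<noteq> {}"
    by (auto simp: R_def G_def S_def)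
  ultimately obtain r where r: "r \<in> R" "\<And>s. s \<in> R \<Longrightarrow> s \<le> r"
    using compact_attains_sup by metis
  txt \<open>Separate the lifted hull from the open ray above its highest point over \<open>y\<close>; since \<open>y\<close> is
    interior, the separating hyperplane is not vertical and its slope is the required \<open>x\<close>.\<close>
  define D where "D = {y} \<times> {r<..}"
  have "convex D" "D \<noteq> {}" "G \<inter> D = {}" "G \<noteq> {}"
    using r by (auto simp: D_def R_def intro!: convex_Times) force
  then obtain a b where a: "a \<noteq> 0" "\<And>z. z \<in> G \<Longrightarrow> a \<bullet> z \<le> b" "\<And>z. z \<in> D \<Longrightarrow> a \<bullet> z \<ge> b"
    using separating_hyperplane_sets[of G D] G by metis
  obtain x c where xc: "a = (x, c)"
    by (cases a)
  have up: "x \<bullet> y + c * s \<ge> b" if "s > r" for s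
    using a(3)[of "(y, s)"] that by (simp add: D_def xc inner_prod_def)
  have yr: "x \<bullet> y + c * r \<le> b"
    using a(2)[of "(y, r)"] r by (simp add: R_def xc inner_prod_def)
  have "c \<ge> 0"
    using up[of "r + 1"] yr by (simp add: algebra_simps)
  have pt: "x \<bullet> p t + c * w t \<le> b" if "t \<in> T" for t
    using a(2)[of "(p t, w t)"] that by (auto simp: G_def S_def xc inner_prod_def intro: hull_inc)
  have eq: "x \<bullet> y + c * r = b"
  proof (rule antisym[OF yr], rule ccontr)
    assume "\<not> b \<le> x \<bullet> y + c * r"
    then have d: "b - (x \<bullet> y + c * r) > 0" by simp
    \<comment> \<open>Dividing by \<open>c + 1\<close> covers \<open>c = 0\<close> as well, and
      \<open>c / (c + 1) < 1\<close> keeps the functional at height \<open>s\<close> below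
      \<open>b\<close>.\<close>
    define s where "s = r + (b - (x \<bullet> y + c * r)) / (c + 1)"
    have "s > r" using d \<open>c \<ge> 0\<close> by (simp add: s_def)
    then have "x \<bullet> y + c * s \<ge> b" by (rule up)
    moreover have "c * s = c * r + c / (c + 1) * (b - (x \<bullet> y + c * r))"
      by (simp add: s_def distrib_left)
    moreover have "c / (c + 1) * (b - (x \<bullet> y + c * r)) < 1 * (b - (x \<bullet> y + c * r))"
      using d \<open>c \<ge> 0\<close> by (intro mult_strict_right_mono) auto
    ultimately show False by simp
  qed
  \<comment> \<open>A vertical hyperplane would support the unlifted hull at its interior point
    \<open>y\<close>.\<close>
  have "c \<noteq> 0"
  proof
    assume c: "c = 0"
    then have x: "x \<noteq> 0" using a(1) xc by (auto simp: zero_prod_def)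
    have "p ` T \<subseteq> {z. x \<bullet> z \<le> b}"
      using pt c by auto
    then have sub: "convex hull (p ` T) \<subseteq> {z. x \<bullet> z \<le> b}"
      by (intro hull_minimal convex_halfspace_le)
    obtain e where e: "e > 0" "ball y e \<subseteq> convex hull (p ` T)"
      using y by (meson mem_interior)
    have "y + (e / (2 * norm x)) *\<^sub>R x \<in> ball y e"
      using e x by (simp add: dist_norm)
    then have "x \<bullet> (y + (e / (2 * norm x)) *\<^sub>R x) \<le> b"
      using e sub by blast
    moreover have "e / (2 * norm x) * (x \<bullet> x) > 0"
      using e x by simp
    ultimately show False
      using eq c by (simp add: inner_add_right)
  qed
  with \<open>c \<ge> 0\<close> have c: "c > 0" by simp
  have "G \<inter> {z. a \<bullet> z = b} face_of G"
    using G a by (intro face_of_Int_supporting_hyperplane_le)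
  then obtain S' where S': "S' \<subseteq> S" "G \<inter> {z. a \<bullet> z = b} = convex hull S'"
    unfolding G_def using T by (elim face_of_convex_hull_subset[rotated])
      (auto simp: S_def finite_imp_compact)
  have "(y, r) \<in> convex hull S'"
    using r eq S'(2) by (auto simp: R_def xc inner_prod_def)
  then have "y \<in> fst ` (convex hull S')"
    by force
  then have yh: "y \<in> convex hull (fst ` S')"
    by (simp add: convex_hull_linear_image linear_fst)
  \<comment> \<open>Dividing by \<open>c > 0\<close> normalises the vertical coefficient to
    \<open>1\<close>, as the definition of slopes requires.\<close>
  have "fst ` S' \<subseteq> p ` max_cell p w T (x /\<^sub>R c)"
  proof
    fix q assume "q \<in> fst ` S'"
    then obtain t where t: "t \<in> T" "(p t, w t) \<in> S'" "q = p t"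
      using S'(1) by (auto simp: S_def)
    then have "(p t, w t) \<in> G \<inter> {z. a \<bullet> z = b}"
      unfolding S'(2) by (intro hull_inc)
    then have tb: "x \<bullet> p t + c * w t = b"
      by (simp add: xc inner_prod_def)
    have scale: "(x /\<^sub>R c) \<bullet> p s + w s = (x \<bullet> p s + c * w s) / c" for s
      using c by (simp add: field_simps)
    have "t \<in> max_cell p w T (x /\<^sub>R c)"
      unfolding max_cell_def scale using t tb pt c by (auto intro!: divide_right_mono)
    then show "q \<in> p ` max_cell p w T (x /\<^sub>R c)"
      using t by blast
  qed
  then show ?thesis
    using yh hull_mono[of "fst ` S'" "p ` max_cell p w T (x /\<^sub>R c)"] by blast
qed

lemma lmeasurable_convex_hull_finite:
  fixes S :: "'a::euclidean_space set"
  shows "finite S \<Longrightarrow> convex hull S \<in> lmeasurable"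
  by (intro lmeasurable_compact finite_imp_compact_convex_hull)

text \<open>What the cells over \<open>X\<close> leave uncovered lies in the boundary or in a flat
  cell, and overlaps are negligible. Allowing any finite \<open>X\<close> that contains the slopes
  of full cells lets one index set serve several configurations.\<close>

lemma measure_convex_hull_eq_sum_max_cells:
  assumes T: "finite T" and X: "finite X"
    and full: "\<And>x. interior (convex hull (p ` max_cell p w T x)) \<noteq> {} \<Longrightarrow> x \<in> X"
  shows "measure lebesgue (convex hull (p ` T))
       = (\<Sum>x\<in>X. measure lebesgue (convex hull (p ` max_cell p w T x)))"
proof -
  define F where "F x = convex hull (p ` max_cell p w T x)" for x
  have fin: "finite (max_cell p w T x)" for x
    by (rule finite_subset[OF max_cell_subset T])
  have Fm: "F x \<in> lmeasurable" for x
    unfolding F_def using fin by (intro lmeasurable_convex_hull_finite) auto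
  have FK: "F x \<subseteq> convex hull (p ` T)" for x
    unfolding F_def by (intro hull_mono image_mono max_cell_subset)
  define N where "N = \<Union>{F x | x. interior (F x) = {}}"
  \<comment> \<open>There may be infinitely many slopes, but cells are subsets of the finite set
    \<open>T\<close>.\<close>
  have "finite {F x | x. interior (F x) = {}}"
  proof (rule finite_subset)
    show "{F x | x. interior (F x) = {}} \<subseteq> (\<lambda>C. convex hull (p ` C)) ` Pow T"
      using max_cell_subset[of p w T] by (auto simp: F_def)
  qed (use T in auto)
  then have N: "negligible N"
    unfolding N_def
  proof (rule negligible_Union)
    fix S assume "S \<in> {F x | x. interior (F x) = {}}"
    then show "negligible S"
      by (auto simp: F_def negligible_convex_interior convex_convex_hull)
  qed
  have "convex hull (p ` T) - \<Union>(F ` X) \<subseteq> frontier (convex hull (p ` T)) \<union> N"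
  proof
    fix y assume y: "y \<in> convex hull (p ` T) - \<Union>(F ` X)"
    show "y \<in> frontier (convex hull (p ` T)) \<union> N"
    proof (cases "y \<in> interior (convex hull (p ` T))")
      case True
      then obtain x where x: "y \<in> F x"
        using interior_subset_Union_max_cells[OF T, of y p w] by (auto simp: F_def)
      then have "x \<notin> X" using y by auto
      then have "interior (F x) = {}" using full[of x] by (auto simp: F_def)
      then show ?thesis
        using x by (auto simp: N_def)
    next
      case False
      then show ?thesis
        using y closure_subset by (auto simp: frontier_def)
    qed
  qed
  then have "negligible (convex hull (p ` T) - \<Union>(F ` X))"
    by (rule negligible_subset[rotated])
       (auto intro!: negligible_Un N negligible_convex_frontier convex_convex_hull)
  moreover have "\<Union>(F ` X) - convex hull (p ` T) = {}"
    using FK by auto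
  ultimately have "measure lebesgue (\<Union>(F ` X)) = measure lebesgue (convex hull (p ` T))"
    using T by (intro measure_negligible_symdiff lmeasurable_convex_hull_finite) auto
  moreover have "measure lebesgue (\<Union>(F ` X)) = (\<Sum>x\<in>X. measure lebesgue (F x))"
    using X Fm negligible_max_cells_Int
    by (intro measure_negligible_finite_Union_image) (auto simp: pairwise_def F_def)
  ultimately show ?thesis
    by (simp add: F_def)
qed

text \<open>A cell with two slopes would be its own overlap, hence negligible; full-dimensional
  cells determine their slope.\<close>

lemma finite_full_max_cells:
  assumes "finite T"
  shows "finite {x. interior (convex hull (p ` max_cell p w T x)) \<noteq> {}}" (is "finite ?X")
proof -
  have "inj_on (max_cell p w T) ?X"
  proof (rule inj_onI, rule ccontr)
    fix x x' assume "x \<in> ?X" and eq: "max_cell p w T x = max_cell p w T x'" and "x \<noteq> x'"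
    then have "negligible (convex hull (p ` max_cell p w T x))"
      using negligible_max_cells_Int[of x x' p w T] by simp
    with \<open>x \<in> ?X\<close> show False
      by (simp add: negligible_convex_interior)
  qed
  moreover have "max_cell p w T ` ?X \<subseteq> Pow T"
    using max_cell_subset[of p w T] by auto
  ultimately show ?thesis
    using assms by (meson finite_Pow_iff finite_imageD finite_subset)
qed

section \<open>Mixed volumes and Minkowski sums\<close>

lemma msum_eq_sum: "finite I \<Longrightarrow> msum K I = (\<Sum>i\<in>I. K i)"
  by (simp add: msum_def set_sum_alt)

text \<open>Parametrising a Minkowski sum by choice functions attaches a lifting to the choice of
  summands; the same point may arise from several choices.\<close>

lemma image_sum_PiE: "(\<lambda>s. \<Sum>i\<in>I. s i) ` PiE I S = msum S I"
proof (intro equalityI subsetI)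
  fix y assume "y \<in> msum S I"
  then obtain f where f: "y = (\<Sum>i\<in>I. f i)" "\<forall>i\<in>I. f i \<in> S i"
    by (auto simp: msum_def)
  then have "y = (\<Sum>i\<in>I. restrict f I i)" "restrict f I \<in> PiE I S"
    by auto
  then show "y \<in> (\<lambda>s. \<Sum>i\<in>I. s i) ` PiE I S"
    by blast
qed (auto simp: msum_def)

lemma convex_hull_msum:
  fixes S :: "'i \<Rightarrow> 'a::euclidean_space set"
  shows "finite I \<Longrightarrow> convex hull (msum S I) = msum (\<lambda>i. convex hull (S i)) I"
  by (simp add: msum_eq_sum convex_hull_set_sum)

text \<open>Fixing one point in each further body puts a translate of the smaller sum inside the
  larger one.\<close>

lemma interior_msum_nonempty_mono:
  fixes K :: "'i \<Rightarrow> 'a::euclidean_space set"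
  assumes "finite J" "I \<subseteq> J" "\<And>i. i \<in> J \<Longrightarrow> K i \<noteq> {}" "interior (msum K I) \<noteq> {}"
  shows "interior (msum K J) \<noteq> {}"
proof -
  obtain f where f: "\<And>i. i \<in> J \<Longrightarrow> f i \<in> K i"
    using bchoice[of J "\<lambda>i y. y \<in> K i"] assms(3) by blast
  have "(+) (\<Sum>i\<in>J - I. f i) ` msum K I \<subseteq> msum K J"
  proof
    fix y assume "y \<in> (+) (\<Sum>i\<in>J - I. f i) ` msum K I"
    then obtain g where g: "y = (\<Sum>i\<in>J - I. f i) + (\<Sum>i\<in>I. g i)" "\<forall>i\<in>I. g i \<in> K i"
      by (auto simp: msum_def)
    define h where "h i = (if i \<in> I then g i else f i)" for i
    have "(\<Sum>i\<in>J. h i) = (\<Sum>i\<in>J - I. h i) + (\<Sum>i\<in>I. h i)"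
      using assms by (intro sum.subset_diff) auto
    also have "\<dots> = y"
      by (simp add: g h_def)
    finally show "y \<in> msum K J"
      using f g by (auto simp: msum_def h_def intro!: exI[of _ h])
  qed
  then have "(+) (\<Sum>i\<in>J - I. f i) ` interior (msum K I) \<subseteq> interior (msum K J)"
    by (simp flip: interior_translation add: interior_mono)
  then show ?thesis
    using assms(4) by blast
qed

text \<open>A sum over independent choices is maximal exactly when every summand is, as exchanging
  one coordinate shows. So the cell of slope \<open>x\<close> in any partial sum is built from the
  cells of the summands at the same slope, which is the coherence of the subdivisions.\<close>

lemma max_cell_PiE:
  fixes A :: "'i \<Rightarrow> 'a::euclidean_space set"
  assumes "finite I"
  shows "max_cell (\<lambda>s. \<Sum>i\<in>I. s i) (\<lambda>s. \<Sum>i\<in>I. w i (s i)) (PiE I A) x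
       = PiE I (\<lambda>i. max_cell (\<lambda>a. a) (w i) (A i) x)"
proof -
  define g where "g i a = x \<bullet> a + w i a" for i a
  have g: "x \<bullet> (\<Sum>i\<in>I. s i) + (\<Sum>i\<in>I. w i (s i)) = (\<Sum>i\<in>I. g i (s i))" for s
    by (simp add: g_def inner_sum_right sum.distrib)
  show ?thesis
    unfolding max_cell_def g g_def[symmetric]
  proof (intro equalityI subsetI)
    fix s assume "s \<in> {t \<in> PiE I A. \<forall>s\<in>PiE I A. (\<Sum>i\<in>I. g i (s i)) \<le> (\<Sum>i\<in>I. g i (t i))}"
    then have s: "s \<in> PiE I A" "\<And>t. t \<in> PiE I A \<Longrightarrow> (\<Sum>i\<in>I. g i (t i)) \<le> (\<Sum>i\<in>I. g i (s i))"
      by auto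
    have "g j b \<le> g j (s j)" if "j \<in> I" "b \<in> A j" for j b
    proof -
      have "(\<Sum>i\<in>I. g i ((s(j := b)) i)) \<le> (\<Sum>i\<in>I. g i (s i))"
        using that s(1) by (intro s(2)) (auto simp: PiE_iff extensional_def)
      moreover have "(\<Sum>i\<in>I. g i ((s(j := b)) i)) = g j b + (\<Sum>i\<in>I - {j}. g i (s i))"
        using that assms by (simp add: sum.remove)
      moreover have "(\<Sum>i\<in>I. g i (s i)) = g j (s j) + (\<Sum>i\<in>I - {j}. g i (s i))"
        using that assms by (simp add: sum.remove)
      ultimately show ?thesis by simp
    qed
    then show "s \<in> PiE I (\<lambda>i. {t \<in> A i. \<forall>s\<in>A i. g i s \<le> g i t})"
      using s(1) by (auto simp: PiE_iff)
  qed (auto simp: PiE_iff intro!: sum_mono)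
qed

abbreviation cells :: "('i \<Rightarrow> 'a \<Rightarrow> real) \<Rightarrow> ('i \<Rightarrow> 'a::euclidean_space set) \<Rightarrow> 'a \<Rightarrow> 'i \<Rightarrow> 'a set" where
  "cells w A x i \<equiv> max_cell (\<lambda>a. a) (w i) (A i) x"

text \<open>Volume is additive over the cells of each partial sum, and the polarization formula is
  linear in these volumes. One \<open>X\<close> serves all \<open>I\<close>, since a partial sum
  with interior gives a full sum with interior. The freedom in \<open>Y\<close> allows prescribed
  slopes to be added.\<close>

lemma mixed_volume_eq_sum_cells:
  fixes A :: "'n::finite \<Rightarrow> (real^'n) set"
  assumes A: "\<And>i. finite (A i)" "\<And>i. A i \<noteq> {}"
  obtains X where "finite X"
    "\<forall>Y. finite Y \<and> X \<subseteq> Y \<longrightarrow> mixed_volume (\<lambda>i. convex hull (A i))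
       = (\<Sum>x\<in>Y. mixed_volume (\<lambda>i. convex hull (cells w A x i)))"
proof -
  define F where "F x i = convex hull (cells w A x i)" for x i
  define p :: "'n set \<Rightarrow> ('n \<Rightarrow> real^'n) \<Rightarrow> real^'n" where "p I s = (\<Sum>i\<in>I. s i)" for I s
  define v where "v I s = (\<Sum>i\<in>I. w i (s i))" for I s
  have hullA: "convex hull (p I ` PiE I A) = msum (\<lambda>i. convex hull (A i)) I" for I
    by (simp add: p_def[abs_def] image_sum_PiE convex_hull_msum)
  have hullF: "convex hull (p I ` max_cell (p I) (v I) (PiE I A) x) = msum (F x) I" for I x
    by (simp add: p_def[abs_def] v_def[abs_def] max_cell_PiE image_sum_PiE convex_hull_msum F_def[abs_def])
  have finT: "finite (PiE I A)" for I
    using A by (intro finite_PiE) auto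
  define X where "X = {x. interior (msum (F x) UNIV) \<noteq> {}}"
  have "finite X"
    using finite_full_max_cells[OF finT[of UNIV], of "p UNIV" "v UNIV"] by (simp add: X_def hullF)
  moreover have "mixed_volume (\<lambda>i. convex hull (A i)) = (\<Sum>x\<in>Y. mixed_volume (F x))"
    if Y: "finite Y" "X \<subseteq> Y" for Y
  proof -
    have "measure lebesgue (msum (\<lambda>i. convex hull (A i)) I) = (\<Sum>x\<in>Y. measure lebesgue (msum (F x) I))" for I
      unfolding hullA[symmetric] hullF[symmetric]
    proof (rule measure_convex_hull_eq_sum_max_cells[OF finT Y(1)])
      fix x assume "interior (convex hull p I ` max_cell (p I) (v I) (PiE I A) x) \<noteq> {}"
      then have "interior (msum (F x) UNIV) \<noteq> {}"
        unfolding hullF by (intro interior_msum_nonempty_mono[of UNIV I])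
          (auto simp: F_def A max_cell_nonempty)
      then show "x \<in> Y" using Y(2) by (auto simp: X_def)
    qed
    then show ?thesis
      unfolding mixed_volume_def
      by (simp add: sum_distrib_left sum.swap[of _ Y])
  qed
  ultimately show ?thesis
    using that unfolding F_def by blast
qed

text \<open>Adding \<open>j\<close> to \<open>I\<close> only translates the Minkowski sum and flips
  the sign, so the terms cancel in pairs.\<close>

lemma mixed_volume_eq_0_if_singleton:
  fixes K :: "'n::finite \<Rightarrow> (real^'n) set"
  assumes j: "K j = {a}"
  shows "mixed_volume K = 0"
proof -
  define f where "f I = (-1) ^ (CARD('n) - card I) * measure lebesgue (msum K I)" for I
  have f0: "f {} = 0"
    by (simp add: f_def msum_def)
  have pair: "f (insert j I) = - f I" if "j \<notin> I" for I
  proof -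
    have "msum K (insert j I) = (+) a ` msum K I"
      using that by (auto simp: msum_eq_sum j set_plus_def)
    moreover have "card I < CARD('n)"
      using that by (intro psubset_card_mono) auto
    then have "CARD('n) - card I = Suc (CARD('n) - card (insert j I))"
      using that by (simp add: Suc_diff_Suc)
    ultimately show ?thesis
      by (simp add: f_def measure_translation)
  qed
  have "(\<Sum>I\<in>{I. I \<subseteq> (UNIV::'n set) \<and> I \<noteq> {}}. f I) = (\<Sum>I\<in>Pow UNIV. f I)"
    using f0 by (intro sum.mono_neutral_left) auto
  also have "(Pow UNIV :: 'n set set) = Pow (UNIV - {j}) \<union> insert j ` Pow (UNIV - {j})"
    by (metis Pow_insert insert_Diff_single insert_UNIV)
  also have "(\<Sum>I\<in>\<dots>. f I) = (\<Sum>I\<in>Pow (UNIV - {j}). f I) + (\<Sum>I\<in>insert j ` Pow (UNIV - {j}). f I)"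
    by (intro sum.union_disjoint) auto
  also have "(\<Sum>I\<in>insert j ` Pow (UNIV - {j}). f I) = (\<Sum>I\<in>Pow (UNIV - {j}). f (insert j I))"
    by (intro sum.reindex_cong[of "insert j"]) (auto intro!: inj_onI)
  also have "\<dots> = (\<Sum>I\<in>Pow (UNIV - {j}). - f I)"
    by (intro sum.cong) (auto intro!: pair)
  finally show ?thesis
    by (simp add: mixed_volume_def f_def sum_negf)
qed

lemma negligible_msum_parallel_hyperplanes:
  fixes K :: "'i \<Rightarrow> 'a::euclidean_space set"
  assumes "u \<noteq> 0" "\<And>i x. i \<in> I \<Longrightarrow> x \<in> K i \<Longrightarrow> u \<bullet> x = c i"
  shows "negligible (msum K I)"
proof (rule negligible_subset)
  show "negligible {x. u \<bullet> x = (\<Sum>i\<in>I. c i)}"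
    using assms(1) by (intro negligible_hyperplane) auto
  show "msum K I \<subseteq> {x. u \<bullet> x = (\<Sum>i\<in>I. c i)}"
    using assms(2) by (auto simp: msum_def inner_sum_right intro!: sum.cong)
qed

lemma mixed_volume_eq_0_if_parallel_hyperplanes:
  fixes K :: "'n::finite \<Rightarrow> (real^'n) set"
  assumes "u \<noteq> 0" "\<And>i x. x \<in> K i \<Longrightarrow> u \<bullet> x = c i"
  shows "mixed_volume K = 0"
  using negligible_msum_parallel_hyperplanes[of u _ K c] assms
  by (simp add: mixed_volume_def negligible_imp_measure0)

text \<open>Coefficients are indexed by the family and not by its range, so that a repeated vector
  counts as a dependence.\<close>

definition independent_family :: "('i::finite \<Rightarrow> 'a::real_vector) \<Rightarrow> bool" where
  "independent_family v \<longleftrightarrow> (\<forall>c. (\<Sum>i\<in>UNIV. c i *\<^sub>R v i) = 0 \<longrightarrow> (\<forall>i. c i = 0))"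

text \<open>The family has as many members as the dimension, so it is a basis and its orthogonal
  complement is trivial.\<close>

lemma independent_familyD_orthogonal:
  fixes v :: "'n::finite \<Rightarrow> real^'n"
  assumes v: "independent_family v" and u: "\<And>i. u \<bullet> v i = 0"
  shows "u = 0"
proof -
  define f where "f c = (\<Sum>i\<in>UNIV. (c $ i) *\<^sub>R v i)" for c :: "real^'n"
  have f: "linear f"
    by (auto simp: linear_iff f_def sum.distrib scaleR_add_left scaleR_sum_right)
  have "inj f"
    using v by (auto simp: linear_injective_0[OF f] f_def independent_family_def vec_eq_iff)
  then have "surj f"
    using f linear_injective_imp_surjective by blast
  then obtain c where "u = f c"
    by blast
  then have "u \<bullet> u = (\<Sum>i\<in>UNIV. c $ i * (u \<bullet> v i))"
    by (simp add: f_def inner_sum_right)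
  then show ?thesis
    using u by simp
qed

text \<open>A proper partial sum of the segments lies in a hyperplane, so only the term for
  \<open>UNIV\<close> survives: the volume of a nondegenerate parallelotope.\<close>

lemma mixed_volume_segments_pos:
  fixes a b :: "'n::finite \<Rightarrow> real^'n"
  assumes ind: "independent_family (\<lambda>i. b i - a i)"
  shows "mixed_volume (\<lambda>i. convex hull {a i, b i}) > 0"
proof -
  define K where "K i = convex hull {a i, b i}" for i
  have hullK: "convex hull (msum (\<lambda>i. {a i, b i}) I) = msum K I" for I
    by (simp add: convex_hull_msum K_def[abs_def])
  have lm: "msum K I \<in> lmeasurable" for I
    unfolding hullK[symmetric]
    by (intro lmeasurable_convex_hull_finite) (auto simp: msum_eq_sum intro!: finite_set_sum)
  have zero: "measure lebesgue (msum K I) = 0" if "I \<noteq> UNIV" for I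
  proof -
    have "dim ((\<lambda>i. b i - a i) ` I) \<le> card ((\<lambda>i. b i - a i) ` I)"
      by (intro dim_le_card') auto
    also have "\<dots> \<le> card I"
      by (intro card_image_le) auto
    also have "\<dots> < CARD('n)"
      using that by (intro psubset_card_mono) auto
    finally obtain u where u: "u \<noteq> 0" "span ((\<lambda>i. b i - a i) ` I) \<subseteq> {x. u \<bullet> x = 0}"
      using lowdim_subset_hyperplane[of "(\<lambda>i. b i - a i) ` I"] by auto
    have "u \<bullet> x = u \<bullet> a i" if "i \<in> I" "x \<in> K i" for i x
    proof -
      have "u \<bullet> (b i - a i) = 0"
        using u(2) that(1) by (auto intro: span_base)
      then have "convex hull {a i, b i} \<subseteq> {x. u \<bullet> x = u \<bullet> a i}"
        by (intro hull_minimal convex_hyperplane) (auto simp: inner_diff_right)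
      then show ?thesis using that(2) by (auto simp: K_def)
    qed
    then have "negligible (msum K I)"
      by (rule negligible_msum_parallel_hyperplanes[OF u(1)])
    then show ?thesis
      by (rule negligible_imp_measure0)
  qed
  have "interior (msum K UNIV) \<noteq> {}"
  proof
    assume int: "interior (msum K UNIV) = {}"
    have conv: "convex (msum K UNIV)"
      unfolding hullK[symmetric] by simp
    obtain u c where u: "u \<noteq> 0" "msum K UNIV \<subseteq> {x. u \<bullet> x = c}"
      by (rule empty_interior_subset_hyperplane[OF conv int])
    have "u \<bullet> (b j - a j) = 0" for j
    proof -
      have m: "(\<Sum>i\<in>UNIV. f i) \<in> msum K UNIV" if "\<And>i. f i \<in> {a i, b i}" for f
        unfolding hullK[symmetric] using that by (intro hull_inc) (auto simp: msum_def)
      \<comment> \<open>Switching only the \<open>j\<close>-th summand moves between two points of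
        the sum by \<open>b j - a j\<close>.\<close>
      have "(\<Sum>i\<in>UNIV. a i) \<in> msum K UNIV" "(\<Sum>i\<in>UNIV. (a(j := b j)) i) \<in> msum K UNIV"
        by (auto intro!: m simp del: fun_upd_apply) (auto)
      then have "u \<bullet> (\<Sum>i\<in>UNIV. (a(j := b j)) i) = u \<bullet> (\<Sum>i\<in>UNIV. a i)"
        using u(2) by auto
      then show ?thesis
        by (simp add: sum.remove[of UNIV j] inner_add_right inner_diff_right)
    qed
    then show False
      using independent_familyD_orthogonal[OF ind] u(1) by blast
  qed
  then have "measure lebesgue (msum K UNIV) > 0"
    using lm[of UNIV] negligible_convex_interior[of "msum K UNIV"]
    by (simp add: negligible_iff_measure zero_less_measure_iff flip: hullK)
  moreover have "(\<Sum>I\<in>{I. I \<subseteq> (UNIV::'n set) \<and> I \<noteq> {}}. (-1) ^ (CARD('n) - card I) * measure lebesgue (msum K I))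
     = (\<Sum>I\<in>{UNIV}. (-1) ^ (CARD('n) - card I) * measure lebesgue (msum K I))"
    using zero by (intro sum.mono_neutral_right) auto
  ultimately show ?thesis
    by (simp add: mixed_volume_def K_def[abs_def])
qed

text \<open>The working criterion for positive mixed volume; for nonempty sets Rado's theorem
  identifies it with essentiality.\<close>

definition has_independent_segments :: "('n::finite \<Rightarrow> (real^'n) set) \<Rightarrow> bool" where
  "has_independent_segments K \<longleftrightarrow>
     (\<exists>a b. (\<forall>i. a i \<in> K i \<and> b i \<in> K i) \<and> independent_family (\<lambda>i. b i - a i))"

lemma has_independent_segments_mono:
  "has_independent_segments K \<Longrightarrow> (\<And>i. K i \<subseteq> L i) \<Longrightarrow> has_independent_segments L"
  unfolding has_independent_segments_def by blast

section \<open>Positivity and monotonicity of the mixed volume\<close>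

lemma cayley_vectors_dependent_imp_lifting:
  fixes A :: "'n::finite \<Rightarrow> (real^'n) set"
  assumes A: "\<And>i. A i \<noteq> {}"
    and dep: "dependent (\<Union>i. (\<lambda>a. (a, axis i (1::real))) ` A i)"
  obtains w where "\<And>x. \<exists>i. cells w A x i \<noteq> A i"
proof -
  define W where "W = (\<Union>i. (\<lambda>a. (a, axis i (1::real))) ` A i)"
  obtain z where z: "z \<in> W" "z \<in> span (W - {z})"
    using dep unfolding W_def dependent_def by blast
  then obtain j q where jq: "z = (q, axis j 1)" "q \<in> A j"
    by (auto simp: W_def)
  txt \<open>Lift only one vector that depends on the others: no linear functional induces this lifting.\<close>
  define w where "w i a = (if i = j \<and> a = q then 1 else 0 :: real)" for i a
  have "\<exists>i. cells w A x i \<noteq> A i" for x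
  proof (rule ccontr)
    assume "\<not> ?thesis"
    then have all: "cells w A x i = A i" for i
      by blast
    obtain f where f: "\<And>i. f i \<in> A i"
      using A that[of "\<lambda>i. SOME a. a \<in> A i"] by (simp add: some_in_eq)
    define c where "c = (\<chi> i. x \<bullet> f i + w i (f i))"
    have c: "x \<bullet> a + w i a = c $ i" if "a \<in> A i" for i a
    proof -
      have "a \<in> cells w A x i" "f i \<in> cells w A x i"
        using all that f by auto
      then show ?thesis
        by (force simp: max_cell_def c_def intro: antisym)
    qed
    \<comment> \<open>If all cells were improper, \<open>(x, - c)\<close> would vanish on
      \<open>W - {z}\<close>, hence on its span, which contains \<open>z\<close>; but its value at
      \<open>z\<close> is \<open>-1\<close>.\<close>
    have "W - {z} \<subseteq> {y. (x, - c) \<bullet> y = 0}"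
    proof
      fix y assume "y \<in> W - {z}"
      then obtain i a where ia: "a \<in> A i" "y = (a, axis i 1)" "y \<noteq> z"
        by (auto simp: W_def)
      then have "w i a = 0"
        by (auto simp: w_def jq)
      then show "y \<in> {y. (x, - c) \<bullet> y = 0}"
        using c[OF ia(1)] by (simp add: ia inner_axis)
    qed
    then have "span (W - {z}) \<subseteq> {y. (x, - c) \<bullet> y = 0}"
      by (intro span_minimal subspace_hyperplane)
    then have "(x, - c) \<bullet> z = 0"
      using z by blast
    then show False
      using c[OF jq(2)] by (simp add: jq inner_axis w_def)
  qed
  then show ?thesis
    using that by blast
qed

text \<open>Both endpoints of a segment carry the same tag \<open>axis i 1\<close>, so a relation
  among the differences lifts to one among the Cayley vectors.\<close>

lemma independent_cayley_vectors_imp_independent_family: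
  fixes a b :: "'n::finite \<Rightarrow> 'a::euclidean_space"
  assumes ind: "independent (\<Union>i. (\<lambda>a. (a, axis i (1::real))) ` {a i, b i})"
    and ne: "\<And>i. a i \<noteq> b i"
  shows "independent_family (\<lambda>i. b i - a i)"
  unfolding independent_family_def
proof (intro allI impI)
  fix c j assume c: "(\<Sum>i\<in>UNIV. c i *\<^sub>R (b i - a i)) = 0"
  define W where "W = (\<Union>i. (\<lambda>a. (a, axis i (1::real))) ` {a i, b i})"
  define z where "z i = (b i, axis i (1::real) :: real^'n)" for i
  define z' where "z' i = (a i, axis i (1::real) :: real^'n)" for i
  have ax: "axis i (1::real) = axis k 1 \<Longrightarrow> i = k" for i k :: 'n
    by (simp add: axis_eq_axis)
  have W: "z i \<in> W" "z' i \<in> W" for i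
    by (auto simp: W_def z_def z'_def)
  show "c j = 0"
  proof (rule ccontr)
    assume nz: "c j \<noteq> 0"
    have sum0: "(\<Sum>i\<in>UNIV. c i *\<^sub>R (z i - z' i)) = 0"
    proof -
      have "(\<Sum>i\<in>UNIV. c i *\<^sub>R (z i - z' i)) = (\<Sum>i\<in>UNIV. (c i *\<^sub>R (b i - a i), 0))"
        by (simp add: z_def z'_def)
      also have "\<dots> = (0, 0)"
        by (simp add: sum_prod c)
      finally show ?thesis by (simp add: zero_prod_def)
    qed
    have "z j = z' j - (\<Sum>i\<in>UNIV - {j}. (c i / c j) *\<^sub>R (z i - z' i))"
    proof -
      have "c j *\<^sub>R (z j - z' j) = - (\<Sum>i\<in>UNIV - {j}. c i *\<^sub>R (z i - z' i))"
        using sum0 by (simp add: sum.remove[of UNIV j] add_eq_0_iff)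
      then have "(1 / c j) *\<^sub>R (c j *\<^sub>R (z j - z' j)) = (1 / c j) *\<^sub>R (- (\<Sum>i\<in>UNIV - {j}. c i *\<^sub>R (z i - z' i)))"
        by simp
      then have "z j - z' j = - (\<Sum>i\<in>UNIV - {j}. (c i / c j) *\<^sub>R (z i - z' i))"
        using nz by (simp add: scaleR_sum_right)
      then show ?thesis
        by (simp add: algebra_simps)
    qed
    also have "\<dots> \<in> span (W - {z j})"
    proof (intro span_diff span_sum span_scale span_base)
      show "z' j \<in> W - {z j}"
        using W ne[of j] by (auto simp: z_def z'_def)
      fix i assume "i \<in> UNIV - {j}"
      then show "z i \<in> W - {z j}" "z' i \<in> W - {z j}"
        using W by (auto simp: z_def z'_def dest: ax)
    qed
    finally have "z j \<in> span (W - {z j})" .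
    then show False
      using ind W(1)[of j] unfolding W_def dependent_def by blast
  qed
qed

lemma card_cayley_vectors:
  fixes A :: "'n::finite \<Rightarrow> 'a set"
  assumes "\<And>i. finite (A i)"
  shows "card (\<Union>i. (\<lambda>a. (a, axis i (1::real))) ` A i) = (\<Sum>i\<in>UNIV. card (A i))"
proof -
  have "card (\<Union>i\<in>UNIV. (\<lambda>a. (a, axis i (1::real))) ` A i) = (\<Sum>i\<in>UNIV. card ((\<lambda>a. (a, axis i (1::real))) ` A i))"
    using assms by (intro card_UN_disjoint) (auto simp: axis_eq_axis)
  also have "\<dots> = (\<Sum>i\<in>UNIV. card (A i))"
    by (intro sum.cong refl card_image inj_onI) auto
  finally show ?thesis .
qed

lemma family_of_pairs:
  fixes A :: "'n::finite \<Rightarrow> 'a set"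
  assumes ge: "\<And>i. 2 \<le> card (A i)" and le: "(\<Sum>i\<in>UNIV. card (A i)) \<le> 2 * CARD('n)"
  obtains a b where "\<And>i. A i = {a i, b i}" "\<And>i. a i \<noteq> b i"
proof -
  have "card (A i) = 2" for i
  proof (rule ccontr)
    assume "card (A i) \<noteq> 2"
    then have "2 < card (A i)" using ge[of i] by simp
    then have "(\<Sum>i\<in>(UNIV::'n set). 2) < (\<Sum>i\<in>UNIV. card (A i))"
      using ge by (intro sum_strict_mono_ex1) auto
    with le show False by simp
  qed
  then have "\<forall>i. \<exists>a b. A i = {a, b} \<and> a \<noteq> b"
    by (meson card_2_iff)
  then show ?thesis
    using that by metis
qed

text \<open>Induction on the total number of points. Dependent Cayley vectors admit a lifting with
  only smaller cell families. Independent ones number at most \<open>2 * CARD('n)\<close>, so either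
  some set is a singleton or all are pairs.\<close>

lemma mixed_volume_nonneg_and_pos:
  fixes A :: "'n::finite \<Rightarrow> (real^'n) set"
  assumes "\<And>i. finite (A i)" "\<And>i. A i \<noteq> {}"
  shows "0 \<le> mixed_volume (\<lambda>i. convex hull (A i)) \<and>
    (0 < mixed_volume (\<lambda>i. convex hull (A i)) \<longrightarrow> has_independent_segments A)"
  using assms
proof (induction "\<Sum>i\<in>UNIV. card (A i)" arbitrary: A rule: less_induct)
  case less
  define W where "W = (\<Union>i. (\<lambda>a. (a, axis i (1::real) :: real^'n)) ` A i)"
  show ?case
  proof (cases "dependent W")
    case True
    then obtain w where w: "\<And>x. \<exists>i. cells w A x i \<noteq> A i"
      unfolding W_def using cayley_vectors_dependent_imp_lifting[of A] less.prems(2) by metis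
    have sub: "cells w A x i \<subseteq> A i" for x i
      by (rule max_cell_subset)
    have ne: "cells w A x i \<noteq> {}" for x i
      using less.prems by (intro max_cell_nonempty)
    have fin: "finite (cells w A x i)" for x i
      using finite_subset[OF sub less.prems(1)] .
    have "(\<Sum>i\<in>UNIV. card (cells w A x i)) < (\<Sum>i\<in>UNIV. card (A i))" for x
    proof -
      obtain j where "cells w A x j \<noteq> A j"
        using w by blast
      then have "card (cells w A x j) < card (A j)"
        using sub less.prems(1) by (intro psubset_card_mono) auto
      then show ?thesis
        using sub less.prems(1) by (intro sum_strict_mono_ex1) (auto intro!: card_mono)
    qed
    then have IH: "0 \<le> mixed_volume (\<lambda>i. convex hull (cells w A x i)) \<and>
        (0 < mixed_volume (\<lambda>i. convex hull (cells w A x i)) \<longrightarrow> has_independent_segments (cells w A x))" for x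
      using less.hyps[of "cells w A x"] fin ne by blast
    obtain X where "finite X" and "\<forall>Y. finite Y \<and> X \<subseteq> Y \<longrightarrow>
        mixed_volume (\<lambda>i. convex hull (A i)) = (\<Sum>x\<in>Y. mixed_volume (\<lambda>i. convex hull (cells w A x i)))"
      by (rule mixed_volume_eq_sum_cells[of A w, OF less.prems])
    then have X: "mixed_volume (\<lambda>i. convex hull (A i)) = (\<Sum>x\<in>X. mixed_volume (\<lambda>i. convex hull (cells w A x i)))"
      by blast
    show ?thesis
    proof (intro conjI impI)
      show "0 \<le> mixed_volume (\<lambda>i. convex hull (A i))"
        unfolding X using IH by (intro sum_nonneg) blast
      assume "0 < mixed_volume (\<lambda>i. convex hull (A i))"
      then obtain x where "x \<in> X" "mixed_volume (\<lambda>i. convex hull (cells w A x i)) > 0"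
        unfolding X by (meson not_le sum_nonpos)
      then have "has_independent_segments (cells w A x)"
        using IH by blast
      then show "has_independent_segments A"
        using sub by (rule has_independent_segments_mono)
    qed
  next
    case False
    then have ind: "independent W" by simp
    have "(\<Sum>i\<in>UNIV. card (A i)) = card W"
      unfolding W_def using less.prems(1) by (subst card_cayley_vectors) auto
    also have "\<dots> \<le> DIM((real^'n) \<times> (real^'n))"
      using ind by (rule independent_card_le)
    finally have le: "(\<Sum>i\<in>UNIV. card (A i)) \<le> 2 * CARD('n)"
      by simp
    have pos: "card (A i) \<noteq> 0" for i
      using less.prems by (simp add: card_eq_0_iff)
    show ?thesis
    proof (cases "\<exists>i. card (A i) = 1")
      case True
      then obtain j a where "A j = {a}"
        by (metis card_1_singletonE)
      then have "mixed_volume (\<lambda>i. convex hull (A i)) = 0"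
        by (intro mixed_volume_eq_0_if_singleton[of _ j a]) auto
      then show ?thesis by simp
    next
      case False
      then have ge: "2 \<le> card (A i)" for i
        using pos[of i] by (metis One_nat_def Suc_1 Suc_leI le_neq_implies_less less_one not_less)
      obtain a b where ab: "\<And>i. A i = {a i, b i}" "\<And>i. a i \<noteq> b i"
        using family_of_pairs[OF ge le] by blast
      then have "independent_family (\<lambda>i. b i - a i)"
        using ind unfolding W_def ab(1) by (intro independent_cayley_vectors_imp_independent_family)
      then have "0 < mixed_volume (\<lambda>i. convex hull (A i))" "has_independent_segments A"
        unfolding ab(1) has_independent_segments_def
        by (auto intro!: mixed_volume_segments_pos)
      then show ?thesis by simp
    qed
  qed
qed

lemma mixed_volume_hull_nonneg:
  fixes A :: "'n::finite \<Rightarrow> (real^'n) set"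
  shows "(\<And>i. finite (A i)) \<Longrightarrow> (\<And>i. A i \<noteq> {}) \<Longrightarrow> 0 \<le> mixed_volume (\<lambda>i. convex hull (A i))"
  using mixed_volume_nonneg_and_pos[of A] by blast

section \<open>Monotonicity and lower bounds from subdivisions\<close>

lemma polytope_family_vertices:
  assumes "\<And>i. polytope (P i)"
  obtains v where "\<And>i. finite (v i)" "P = (\<lambda>i. convex hull (v i))"
  using assms unfolding polytope_def by (metis (no_types, lifting) ext)

text \<open>The equality holds over \<open>X \<union> Y\<close>, and the slopes outside
  \<open>Y\<close> contribute nonnegative amounts.\<close>

lemma mixed_volume_ge_sum_cells:
  fixes A :: "'n::finite \<Rightarrow> (real^'n) set"
  assumes A: "\<And>i. finite (A i)" "\<And>i. A i \<noteq> {}" and Y: "finite Y"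
  shows "mixed_volume (\<lambda>i. convex hull (A i)) \<ge> (\<Sum>x\<in>Y. mixed_volume (\<lambda>i. convex hull (cells w A x i)))"
proof -
  obtain X where X: "finite X" "\<forall>Y. finite Y \<and> X \<subseteq> Y \<longrightarrow> mixed_volume (\<lambda>i. convex hull (A i))
       = (\<Sum>x\<in>Y. mixed_volume (\<lambda>i. convex hull (cells w A x i)))"
    by (rule mixed_volume_eq_sum_cells[of A w, OF A])
  have "0 \<le> mixed_volume (\<lambda>i. convex hull (cells w A x i))" for x
    using A by (intro mixed_volume_hull_nonneg max_cell_nonempty finite_subset[OF max_cell_subset])
  then have "(\<Sum>x\<in>Y. mixed_volume (\<lambda>i. convex hull (cells w A x i)))
      \<le> (\<Sum>x\<in>X \<union> Y. mixed_volume (\<lambda>i. convex hull (cells w A x i)))"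
    using X(1) Y by (intro sum_mono2) auto
  also have "\<dots> = mixed_volume (\<lambda>i. convex hull (A i))"
    using X Y by (intro X(2)[rule_format, symmetric]) auto
  finally show ?thesis .
qed

lemma convex_hull_Un_absorb:
  assumes "convex hull S \<subseteq> convex hull T"
  shows "convex hull (S \<union> T) = convex hull T"
proof (rule antisym)
  show "convex hull (S \<union> T) \<subseteq> convex hull T"
    using assms hull_subset[of S convex] hull_subset[of T convex] by (intro hull_minimal) auto
qed (simp add: hull_mono)

lemma cells_indicator_zero:
  assumes "\<And>i. V i \<noteq> {}" "\<And>i. V i \<subseteq> A i"
  shows "cells (\<lambda>i a. if a \<in> V i then 0 else -1) A 0 i = V i"
proof -
  obtain v where "v \<in> V i" "v \<in> A i"
    using assms[of i] by blast
  then show ?thesis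
    using assms(2)[of i] by (auto simp: max_cell_def split: if_splits)
qed

text \<open>\<open>P\<close> is the cell family of slope \<open>0\<close> in a subdivision of
  \<open>Q\<close>, so its mixed volume is one of the nonnegative summands.\<close>

lemma mixed_volume_mono:
  fixes P Q :: "'n::finite \<Rightarrow> (real^'n) set"
  assumes "\<And>i. polytope (P i)" "\<And>i. polytope (Q i)" "\<And>i. P i \<noteq> {}" "\<And>i. P i \<subseteq> Q i"
  shows "mixed_volume P \<le> mixed_volume Q"
proof -
  obtain V where V: "\<And>i. finite (V i)" "P = (\<lambda>i. convex hull (V i))"
    using polytope_family_vertices assms(1) by metis
  obtain U where U: "\<And>i. finite (U i)" "Q = (\<lambda>i. convex hull (U i))"
    using polytope_family_vertices assms(2) by metis
  \<comment> \<open>Points of \<open>V i\<close> need not be vertices of \<open>Q i\<close>; adding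
    them leaves the hull unchanged and makes them available to cells.\<close>
  define A where "A i = V i \<union> U i" for i
  have ne: "V i \<noteq> {}" for i
    using assms(3)[of i] V by auto
  have Q: "Q = (\<lambda>i. convex hull (A i))"
    using assms(4) V U by (auto simp: A_def convex_hull_Un_absorb)
  have A: "\<And>i. finite (A i)" "\<And>i. A i \<noteq> {}"
    using V U ne by (auto simp: A_def)
  define w where "w = (\<lambda>i a. if a \<in> V i then 0 else -1 :: real)"
  have "cells w A 0 i = V i" for i
    unfolding w_def by (rule cells_indicator_zero) (use ne in \<open>auto simp: A_def\<close>)
  moreover have "(\<Sum>x\<in>{0}. mixed_volume (\<lambda>i. convex hull (cells w A x i))) \<le> mixed_volume Q"
    unfolding Q using A by (intro mixed_volume_ge_sum_cells) auto
  ultimately show ?thesis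
    by (simp add: V(2))
qed

text \<open>The segments alone have positive mixed volume, and monotonicity passes this on to
  \<open>K\<close>.\<close>

lemma mixed_volume_pos_if_independent_segments:
  fixes K :: "'n::finite \<Rightarrow> (real^'n) set"
  assumes K: "\<And>i. polytope (K i)" and ind: "has_independent_segments K"
  shows "mixed_volume K > 0"
proof -
  obtain a b where ab: "\<And>i. a i \<in> K i \<and> b i \<in> K i" "independent_family (\<lambda>i. b i - a i)"
    using ind unfolding has_independent_segments_def by blast
  have "0 < mixed_volume (\<lambda>i. convex hull {a i, b i})"
    using ab(2) by (rule mixed_volume_segments_pos)
  also have "\<dots> \<le> mixed_volume K"
    using ab(1) K by (intro mixed_volume_mono hull_minimal) (auto simp: polytope_convex_hull polytope_imp_convex)
  finally show ?thesis .
qed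

section \<open>Support functions and caps\<close>

lemma inner_le_supp_fun:
  assumes "compact K" "x \<in> K"
  shows "u \<bullet> x \<le> supp_fun K u"
proof -
  have "compact ((\<lambda>x. u \<bullet> x) ` K)"
    using assms(1) by (intro compact_continuous_image continuous_intros)
  then show ?thesis
    unfolding supp_fun_def using assms(2)
    by (intro cSup_upper) (auto intro: bounded_imp_bdd_above compact_imp_bounded)
qed

lemma supp_fun_le:
  assumes "K \<noteq> {}" "\<And>x. x \<in> K \<Longrightarrow> u \<bullet> x \<le> c"
  shows "supp_fun K u \<le> c"
  unfolding supp_fun_def using assms by (intro cSup_least) auto

lemma supp_fun_attained:
  assumes "compact K" "K \<noteq> {}"
  obtains x where "x \<in> K" "u \<bullet> x = supp_fun K u"
proof -
  obtain x where "x \<in> K" "\<And>y. y \<in> K \<Longrightarrow> u \<bullet> y \<le> u \<bullet> x"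
    using continuous_attains_sup[of K "\<lambda>x. u \<bullet> x"] assms continuous_on_inner[OF continuous_on_const continuous_on_id]
    by blast
  then show ?thesis
    using that inner_le_supp_fun[OF assms(1)] supp_fun_le[OF assms(2)] by (meson antisym)
qed

lemma polytope_cap:
  fixes Q :: "'a::euclidean_space set"
  assumes "polytope Q"
  shows "polytope {x \<in> Q. u \<bullet> x \<ge> c}"
proof -
  have "{x \<in> Q. u \<bullet> x \<ge> c} = Q \<inter> {x. u \<bullet> x \<ge> c}"
    by auto
  then show ?thesis
    using assms by (auto intro!: polytope_Int_polyhedron polyhedron_halfspace_ge)
qed

lemma cap_nonempty:
  assumes "compact P" "P \<noteq> {}" "P \<subseteq> Q"
  shows "{x \<in> Q. u \<bullet> x \<ge> supp_fun P u} \<noteq> {}"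
proof -
  obtain x where "x \<in> P" "u \<bullet> x = supp_fun P u"
    by (rule supp_fun_attained[OF assms(1,2)])
  then show ?thesis
    using assms(3) by auto
qed

text \<open>When \<open>P\<close> is the cell family of slope \<open>0\<close>, the surplus must
  come from a slope \<open>x \<noteq> 0\<close>. Positivity yields independent segments in those
  cells, which lie in the caps for \<open>x\<close>.\<close>

lemma mixed_volume_less_imp_caps:
  fixes P Q :: "'n::finite \<Rightarrow> (real^'n) set"
  assumes "\<And>i. polytope (P i)" "\<And>i. polytope (Q i)" "\<And>i. P i \<noteq> {}" "\<And>i. P i \<subseteq> Q i"
    and less: "mixed_volume P < mixed_volume Q"
  shows "\<exists>u. u \<noteq> 0 \<and> has_independent_segments (\<lambda>i. {x \<in> Q i. u \<bullet> x \<ge> supp_fun (P i) u})"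
proof -
  obtain V where V: "\<And>i. finite (V i)" "P = (\<lambda>i. convex hull (V i))"
    using polytope_family_vertices assms(1) by metis
  obtain U where U: "\<And>i. finite (U i)" "Q = (\<lambda>i. convex hull (U i))"
    using polytope_family_vertices assms(2) by metis
  define A where "A i = V i \<union> U i" for i
  have ne: "V i \<noteq> {}" for i
    using assms(3)[of i] V by auto
  have Q: "Q = (\<lambda>i. convex hull (A i))"
    using assms(4) V U by (auto simp: A_def convex_hull_Un_absorb)
  have A: "\<And>i. finite (A i)" "\<And>i. A i \<noteq> {}"
    using V U ne by (auto simp: A_def)
  define w where "w = (\<lambda>i a. if a \<in> V i then 0 else -1 :: real)"
  define M where "M x = mixed_volume (\<lambda>i. convex hull (cells w A x i))" for x
  obtain X where X: "finite X" "\<forall>Y. finite Y \<and> X \<subseteq> Y \<longrightarrow> mixed_volume Q = (\<Sum>x\<in>Y. M x)"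
    unfolding Q M_def by (rule mixed_volume_eq_sum_cells[of A w, OF A])
  have "cells w A 0 i = V i" for i
    unfolding w_def by (rule cells_indicator_zero) (use ne in \<open>auto simp: A_def\<close>)
  then have "M 0 = mixed_volume P"
    by (simp add: M_def V(2))
  then have "mixed_volume Q = mixed_volume P + (\<Sum>x\<in>X - {0}. M x)"
    using X(2)[rule_format, of "insert 0 X"] X(1) by (simp add: sum.insert_remove subset_insertI)
  with less have "(\<Sum>x\<in>X - {0}. M x) > 0"
    by simp
  then obtain x where x: "x \<noteq> 0" "M x > 0"
    using sum_nonpos[of "X - {0}" M] by force
  have "has_independent_segments (cells w A x)"
    using mixed_volume_nonneg_and_pos[of "cells w A x"] x(2) A
    by (auto simp: M_def max_cell_nonempty finite_subset[OF max_cell_subset])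
  moreover have "cells w A x i \<subseteq> {y \<in> Q i. x \<bullet> y \<ge> supp_fun (P i) x}" for i
  proof
    fix a assume a: "a \<in> cells w A x i"
    \<comment> \<open>\<open>p\<close> has the top height \<open>0\<close>, so \<open>a\<close> can
      be maximal only by lying at least as far in direction \<open>x\<close>.\<close>
    have "x \<bullet> p \<le> x \<bullet> a" if "p \<in> V i" for p
    proof -
      have "x \<bullet> p + w i p \<le> x \<bullet> a + w i a"
        using a that by (auto simp: max_cell_def A_def)
      then show ?thesis
        using that by (auto simp: w_def split: if_splits)
    qed
    then have "convex hull (V i) \<subseteq> {p. x \<bullet> p \<le> x \<bullet> a}"
      by (intro hull_minimal convex_halfspace_le) auto
    then have "supp_fun (P i) x \<le> x \<bullet> a"
      using assms(3) V(2) by (intro supp_fun_le) auto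
    moreover have "a \<in> Q i"
      using a max_cell_subset unfolding Q by (metis hull_inc subsetD)
    ultimately show "a \<in> {y \<in> Q i. x \<bullet> y \<ge> supp_fun (P i) x}"
      by simp
  qed
  ultimately have "has_independent_segments (\<lambda>i. {y \<in> Q i. x \<bullet> y \<ge> supp_fun (P i) x})"
    by (rule has_independent_segments_mono)
  then show ?thesis
    using x(1) by blast
qed

lemma mixed_volume_superadditive_caps:
  fixes P Q :: "'n::finite \<Rightarrow> (real^'n) set"
  assumes "\<And>i. polytope (P i)" "\<And>i. polytope (Q i)" "\<And>i. P i \<noteq> {}" "\<And>i. P i \<subseteq> Q i" "u \<noteq> 0"
  shows "mixed_volume P + mixed_volume (\<lambda>i. {x \<in> Q i. u \<bullet> x \<ge> supp_fun (P i) u}) \<le> mixed_volume Q"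
proof -
  define h where "h i = supp_fun (P i) u" for i
  define B where "B i = {x \<in> Q i. u \<bullet> x \<ge> h i}" for i
  have B: "polytope (B i)" for i
    unfolding B_def using assms(2) by (rule polytope_cap)
  have Pc: "compact (P i)" for i
    using assms(1) by (rule polytope_imp_compact)
  have Bne: "B i \<noteq> {}" for i
    unfolding B_def h_def using Pc assms(3,4) by (rule cap_nonempty)
  obtain V where V: "\<And>i. finite (V i)" "P = (\<lambda>i. convex hull (V i))"
    using polytope_family_vertices assms(1) by metis
  obtain U where U: "\<And>i. finite (U i)" "Q = (\<lambda>i. convex hull (U i))"
    using polytope_family_vertices assms(2) by metis
  obtain S where S: "\<And>i. finite (S i)" "B = (\<lambda>i. convex hull (S i))"
    using polytope_family_vertices B by metis
  define A where "A i = (V i \<union> S i) \<union> U i" for i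
  have VP: "V i \<subseteq> P i" and SB: "S i \<subseteq> B i" for i
    by (auto simp: V(2) S(2) hull_inc)
  have ne: "V i \<noteq> {}" "S i \<noteq> {}" for i
    using assms(3)[of i] Bne[of i] by (auto simp: V(2) S(2))
  have "convex hull (V i \<union> S i) \<subseteq> Q i" for i
    using VP[of i] SB[of i] assms(2,4)[of i]
    by (intro hull_minimal) (auto simp: B_def polytope_imp_convex)
  then have Q: "Q = (\<lambda>i. convex hull (A i))"
    by (auto simp: A_def U(2) convex_hull_Un_absorb)
  have A: "\<And>i. finite (A i)" "\<And>i. A i \<noteq> {}"
    using V U S ne by (auto simp: A_def)
  txt \<open>Folding along the hyperplanes \<open>u \<bullet> x = h i\<close>: slope \<open>0\<close> selects the side containing \<open>P i\<close>,
    slope \<open>u\<close> selects the cap \<open>B i\<close>.\<close>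
  define w where "w = (\<lambda>i a. - max 0 (u \<bullet> a - h i))"
  have VA: "a \<in> A i" "u \<bullet> a \<le> h i" if "a \<in> V i" for a i
    using that VP[of i] inner_le_supp_fun[OF Pc, of a i u] by (auto simp: A_def h_def)
  have SA: "a \<in> A i" "u \<bullet> a \<ge> h i" if "a \<in> S i" for a i
    using that SB by (auto simp: A_def B_def)
  \<comment> \<open>Inclusions suffice, by monotonicity. At slope \<open>0\<close> the functional is
    the lifting itself, with maximum \<open>0\<close> where
    \<open>u \<bullet> a \<le> h i\<close>.\<close>
  have "V i \<subseteq> cells w A 0 i" for i
  proof
    fix a assume "a \<in> V i"
    from VA[OF this] show "a \<in> cells w A 0 i"
      by (auto simp: max_cell_def w_def)
  qed
  then have "convex hull (V i) \<subseteq> convex hull (cells w A 0 i)" for i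
    by (rule hull_mono)
  then have 0: "mixed_volume P \<le> mixed_volume (\<lambda>i. convex hull (cells w A 0 i))"
    unfolding V(2) using V(1) A ne
    by (intro mixed_volume_mono) (auto intro!: polytope_convex_hull finite_subset[OF max_cell_subset])
  \<comment> \<open>At slope \<open>u\<close> the functional is
    \<open>min (u \<bullet> a) (h i)\<close>, with maximum \<open>h i\<close> on the cap.\<close>
  have "S i \<subseteq> cells w A u i" for i
  proof
    fix a assume "a \<in> S i"
    from SA[OF this] show "a \<in> cells w A u i"
      by (auto simp: max_cell_def w_def)
  qed
  then have "convex hull (S i) \<subseteq> convex hull (cells w A u i)" for i
    by (rule hull_mono)
  then have 1: "mixed_volume B \<le> mixed_volume (\<lambda>i. convex hull (cells w A u i))"
    unfolding S(2) using S(1) A ne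
    by (intro mixed_volume_mono) (auto intro!: polytope_convex_hull finite_subset[OF max_cell_subset])
  have "(\<Sum>x\<in>{0, u}. mixed_volume (\<lambda>i. convex hull (cells w A x i))) \<le> mixed_volume Q"
    unfolding Q using A by (intro mixed_volume_ge_sum_cells) auto
  \<comment> \<open>\<open>u \<noteq> 0\<close> makes the two slopes distinct, so both summands are
    counted.\<close>
  then show ?thesis
    using assms(5) 0 1 by (simp add: B_def[abs_def] h_def)
qed

section \<open>Rado's theorem and essential collections\<close>

text \<open>The dimension formula for the two spans. A general \<open>U\<close> fits the
  application, where it is a union over common indices, possibly smaller than the
  intersection.\<close>

lemma dim_submodular:
  fixes S T :: "'a::euclidean_space set"
  assumes "U \<subseteq> S \<inter> T"
  shows "dim (S \<union> T) + dim U \<le> dim S + dim T"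
proof -
  have "dim (S \<union> T) = dim (span (S \<union> T))"
    by simp
  also have "span (S \<union> T) = {x + y |x y. x \<in> span S \<and> y \<in> span T}"
    by (auto simp: span_Un)
  finally have "dim (S \<union> T) + dim (span S \<inter> span T) = dim (span S) + dim (span T)"
    using dim_sums_Int[of "span S" "span T"] by simp
  moreover have "dim U \<le> dim (span S \<inter> span T)"
    using assms by (intro dim_subset) (auto intro: span_base)
  ultimately show ?thesis by simp
qed

text \<open>Rado's theorem on independent transversals: vectors are deleted one at a time while the
  rank condition survives. Once all sets are singletons, the condition for \<open>UNIV\<close> is
  the conclusion.\<close>

lemma rado_transversal:
  fixes D :: "'i::finite \<Rightarrow> 'a::euclidean_space set"
  assumes "\<And>i. finite (D i)" "\<And>I. card I \<le> dim (\<Union>i\<in>I. D i)"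
  shows "\<exists>v. (\<forall>i. v i \<in> D i) \<and> CARD('i) \<le> dim (range v)"
  using assms
proof (induction "\<Sum>i\<in>UNIV. card (D i)" arbitrary: D rule: less_induct)
  case less
  have ne: "D i \<noteq> {}" for i
    using less.prems(2)[of "{i}"] by auto
  show ?case
  proof (cases "\<exists>j x y. x \<in> D j \<and> y \<in> D j \<and> x \<noteq> y")
    case False
    define v where "v i = (SOME x. x \<in> D i)" for i
    have "v i \<in> D i" for i
      unfolding v_def using ne by (simp add: some_in_eq)
    moreover from this have "(\<Union>i. D i) \<subseteq> range v"
      using False by blast
    then have "dim (\<Union>i. D i) \<le> dim (range v)"
      by (rule dim_subset)
    ultimately show ?thesis
      using less.prems(2)[of UNIV] by (intro exI[of _ v]) auto
  next
    case True
    then obtain j x y where xy: "x \<in> D j" "y \<in> D j" "x \<noteq> y"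
      by blast
    have step: ?thesis
      if z: "z \<in> D j" and cond: "\<And>I. card I \<le> dim (\<Union>i\<in>I. (D(j := D j - {z})) i)" for z
    proof -
      define D' where "D' = D(j := D j - {z})"
      have D': "D' i \<subseteq> D i" for i
        by (auto simp: D'_def)
      have fin: "finite (D' i)" for i
        using D' less.prems(1) by (rule finite_subset)
      have "(\<Sum>i\<in>UNIV. card (D' i)) < (\<Sum>i\<in>UNIV. card (D i))"
      proof (rule sum_strict_mono_ex1)
        show "\<forall>i\<in>UNIV. card (D' i) \<le> card (D i)"
          using D' less.prems(1) by (auto intro: card_mono)
        have "card (D' j) < card (D j)"
          using z less.prems(1)[of j] card_Diff1_less[of "D j" z] by (simp add: D'_def)
        then show "\<exists>i\<in>UNIV. card (D' i) < card (D i)"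
          by blast
      qed auto
      then obtain v where v: "\<And>i. v i \<in> D' i" "CARD('i) \<le> dim (range v)"
        using less.hyps[of D'] fin cond[folded D'_def] by blast
      moreover have "v i \<in> D i" for i
        using v(1) D' by blast
      ultimately show ?thesis
        by blast
    qed
    txt \<open>If deleting \<open>x\<close> and deleting \<open>y\<close> both violated the rank condition, submodularity of the
      dimension would contradict the condition for \<open>D\<close>.\<close>
    have deficient: "\<exists>I. j \<notin> I \<and> dim ((\<Union>i\<in>I. D i) \<union> (D j - {z})) \<le> card I"
      if "\<not> card I \<le> dim (\<Union>i\<in>I. (D(j := D j - {z})) i)" for I z
    proof -
      have "j \<in> I"
      proof (rule ccontr)
        assume "j \<notin> I"
        then have "(\<Union>i\<in>I. (D(j := D j - {z})) i) = (\<Union>i\<in>I. D i)"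
          by auto
        with that less.prems(2)[of I] show False
          by simp
      qed
      then have "(\<Union>i\<in>I. (D(j := D j - {z})) i) = (\<Union>i\<in>I - {j}. D i) \<union> (D j - {z})"
        by (auto split: if_splits)
      moreover have "card I = Suc (card (I - {j}))"
        using \<open>j \<in> I\<close> by (intro card.remove) auto
      ultimately show ?thesis
        using that by (intro exI[of _ "I - {j}"]) auto
    qed
    show ?thesis
    proof (rule ccontr)
      assume no: "\<not> ?thesis"
      obtain I where I: "j \<notin> I" "dim ((\<Union>i\<in>I. D i) \<union> (D j - {x})) \<le> card I"
        using no step[OF xy(1)] deficient[of _ x] by blast
      obtain J where J: "j \<notin> J" "dim ((\<Union>i\<in>J. D i) \<union> (D j - {y})) \<le> card J"
        using no step[OF xy(2)] deficient[of _ y] by blast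
      \<comment> \<open>As \<open>x \<noteq> y\<close>, each deleted vector survives on the other
        side, so all of \<open>D j\<close> is recovered.\<close>
      have "((\<Union>i\<in>I. D i) \<union> (D j - {x})) \<union> ((\<Union>i\<in>J. D i) \<union> (D j - {y})) = (\<Union>i\<in>insert j (I \<union> J). D i)"
        using xy by auto
      then have "dim (\<Union>i\<in>insert j (I \<union> J). D i) + dim (\<Union>i\<in>I \<inter> J. D i)
          \<le> dim ((\<Union>i\<in>I. D i) \<union> (D j - {x})) + dim ((\<Union>i\<in>J. D i) \<union> (D j - {y}))"
        using dim_submodular[of "\<Union>i\<in>I \<inter> J. D i" "(\<Union>i\<in>I. D i) \<union> (D j - {x})" "(\<Union>i\<in>J. D i) \<union> (D j - {y})"]
        by auto
      then have "card (insert j (I \<union> J)) + card (I \<inter> J) \<le> card I + card J"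
        using I(2) J(2) less.prems(2)[of "insert j (I \<union> J)"] less.prems(2)[of "I \<inter> J"] by linarith
      moreover have "card (insert j (I \<union> J)) = Suc (card (I \<union> J))"
        using I(1) J(1) by simp
      ultimately show False
        using card_Un_Int[of I J] by simp
    qed
  qed
qed

lemma independent_family_iff:
  fixes v :: "'i::finite \<Rightarrow> 'a::real_vector"
  shows "independent_family v \<longleftrightarrow> inj v \<and> independent (range v)"
proof
  assume v: "independent_family v"
  have "inj v"
  proof (rule injI, rule ccontr)
    fix i j assume ij: "v i = v j" "i \<noteq> j"
    have "(\<Sum>k\<in>UNIV. (of_bool (k = i) - of_bool (k = j)) *\<^sub>R v k) = 0"
      using ij(1) by (simp add: scaleR_diff_left sum_subtractf of_bool_def if_distrib[of "\<lambda>c. c *\<^sub>R _"] cong: if_cong)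
    from v[unfolded independent_family_def, rule_format, OF this, of i] show False
      using ij(2) by simp
  qed
  moreover have "independent (range v)"
  proof (rule independent_if_scalars_zero)
    fix f x assume "(\<Sum>x\<in>range v. f x *\<^sub>R x) = 0" "x \<in> range v"
    then have "(\<Sum>i\<in>UNIV. f (v i) *\<^sub>R v i) = 0"
      using \<open>inj v\<close> by (simp add: sum.reindex)
    then have "\<forall>i. f (v i) = 0"
      using v unfolding independent_family_def by (elim allE[of _ "\<lambda>i. f (v i)"]) blast
    then show "f x = 0"
      using \<open>x \<in> range v\<close> by blast
  qed simp
  ultimately show "inj v \<and> independent (range v)"
    by blast
next
  assume v: "inj v \<and> independent (range v)"
  show "independent_family v"
    unfolding independent_family_def
  proof (intro allI impI)
    fix c i assume "(\<Sum>i\<in>UNIV. c i *\<^sub>R v i) = 0"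
    then have "(\<Sum>x\<in>range v. c (inv v x) *\<^sub>R x) = 0"
      using v by (simp add: sum.reindex)
    then have "c (inv v (v i)) = 0"
      using v independentD[of "range v" "range v" "\<lambda>x. c (inv v x)" "v i"] by simp
    then show "c i = 0"
      using v by simp
  qed
qed

lemma independent_family_nonzero: "independent_family v \<Longrightarrow> v i \<noteq> 0"
  using dependent_zero[of "range v"] by (metis independent_family_iff rangeI)

text \<open>Rank, number of distinct vectors and number of indices form an increasing chain, which
  the assumption collapses to equalities.\<close>

lemma independent_family_if_card_le_dim:
  fixes v :: "'i::finite \<Rightarrow> 'a::euclidean_space"
  assumes "CARD('i) \<le> dim (range v)"
  shows "independent_family v"
proof -
  have le: "dim (range v) \<le> card (range v)" "card (range v) \<le> CARD('i)"
    by (auto intro: dim_le_card' card_image_le)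
  then have "inj v"
    using assms by (intro eq_card_imp_inj_on) auto
  moreover have "independent (range v)"
    using assms le by (intro card_le_dim_spanning[of "range v" "range v"]) (auto intro: span_base)
  ultimately show ?thesis
    by (simp add: independent_family_iff)
qed

text \<open>Translated by the sum of the base points \<open>a i\<close>, the Minkowski sum contains
  every direction \<open>v j\<close> with \<open>j \<in> I\<close>: switch one endpoint at a
  time.\<close>

lemma has_independent_segments_imp_essential:
  fixes K :: "'n::finite \<Rightarrow> (real^'n) set"
  assumes "has_independent_segments K"
  shows "essential K"
  unfolding essential_def
proof (intro allI impI)
  fix I :: "'n set"
  obtain a b where ab: "\<And>i. a i \<in> K i \<and> b i \<in> K i" "independent_family (\<lambda>i. b i - a i)"
    using assms unfolding has_independent_segments_def by blast
  define v where "v i = b i - a i" for i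
  have v: "inj v" "independent (range v)"
    using ab(2) by (auto simp: independent_family_iff v_def[abs_def])
  define s where "s = (\<Sum>i\<in>I. a i)"
  have s: "s \<in> msum K I"
    using ab(1) by (auto simp: msum_def s_def)
  have "v ` I \<subseteq> (+) (- s) ` msum K I"
  proof
    fix x assume "x \<in> v ` I"
    then obtain j where j: "j \<in> I" "x = v j"
      by blast
    have "(\<Sum>i\<in>I. (a(j := b j)) i) = s + v j"
      using j by (simp add: sum.remove[of I j] s_def v_def)
    moreover have "(\<Sum>i\<in>I. (a(j := b j)) i) \<in> msum K I"
      unfolding msum_def using ab(1) by (intro CollectI exI[of _ "a(j := b j)"]) auto
    ultimately have "s + v j \<in> msum K I"
      by simp
    then show "x \<in> (+) (- s) ` msum K I"
      using j by (intro image_eqI[of _ _ "s + v j"]) auto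
  qed
  then have "dim (v ` I) \<le> dim ((+) (- s) ` msum K I)"
    by (rule dim_subset)
  moreover have "dim (v ` I) = card I"
    using v independent_mono[of "range v" "v ` I"] card_image[of v I] inj_on_subset[of v UNIV I]
    by (simp add: dim_eq_card_independent image_mono)
  moreover have "aff_dim (msum K I) = int (dim ((+) (- s) ` msum K I))"
    using s by (intro aff_dim_eq_dim hull_inc)
  ultimately show "int (card I) \<le> aff_dim (msum K I)"
    by simp
qed

text \<open>Translated to contain \<open>0\<close>, each \<open>K i\<close> has a finite spanning
  subset \<open>D i\<close>. The translated sum over \<open>I\<close> lies in the span of these
  \<open>D i\<close>, so essentiality gives Rado's condition.\<close>

lemma essential_imp_has_independent_segments:
  fixes K :: "'n::finite \<Rightarrow> (real^'n) set"
  assumes ess: "essential K" and ne: "\<And>i. K i \<noteq> {}"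
  shows "has_independent_segments K"
proof -
  define a where "a i = (SOME x. x \<in> K i)" for i
  have a: "a i \<in> K i" for i
    unfolding a_def using ne by (simp add: some_in_eq)
  have "\<exists>D. D \<subseteq> (+) (- a i) ` K i \<and> finite D \<and> (+) (- a i) ` K i \<subseteq> span D" for i
    using basis_exists[of "(+) (- a i) ` K i"] independent_imp_finite by metis
  then obtain D where D: "\<And>i. D i \<subseteq> (+) (- a i) ` K i" "\<And>i. finite (D i)"
      "\<And>i. (+) (- a i) ` K i \<subseteq> span (D i)"
    by metis
  have "card I \<le> dim (\<Union>i\<in>I. D i)" for I
  proof -
    define s where "s = (\<Sum>i\<in>I. a i)"
    have s: "s \<in> msum K I"
      using a by (auto simp: msum_def s_def)
    have "(+) (- s) ` msum K I \<subseteq> span (\<Union>i\<in>I. D i)"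
    proof
      fix x assume "x \<in> (+) (- s) ` msum K I"
      then obtain f where f: "x = - s + (\<Sum>i\<in>I. f i)" "\<forall>i\<in>I. f i \<in> K i"
        by (auto simp: msum_def)
      then have "x = (\<Sum>i\<in>I. - a i + f i)"
        by (simp add: s_def sum_subtractf)
      also have "\<dots> \<in> span (\<Union>i\<in>I. D i)"
      proof (rule span_sum)
        fix i assume i: "i \<in> I"
        then have "- a i + f i \<in> span (D i)"
          using f(2) D(3)[of i] by blast
        moreover have "span (D i) \<subseteq> span (\<Union>i\<in>I. D i)"
          using i by (intro span_mono) auto
        ultimately show "- a i + f i \<in> span (\<Union>i\<in>I. D i)"
          by blast
      qed
      finally show "x \<in> span (\<Union>i\<in>I. D i)" .
    qed
    then have "dim ((+) (- s) ` msum K I) \<le> dim (span (\<Union>i\<in>I. D i))"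
      by (rule dim_subset)
    moreover have "aff_dim (msum K I) = int (dim ((+) (- s) ` msum K I))"
      using s by (intro aff_dim_eq_dim hull_inc)
    moreover have "int (card I) \<le> aff_dim (msum K I)"
      using ess card_mono[of UNIV I] by (simp add: essential_def)
    ultimately show ?thesis
      by simp
  qed
  then obtain v where v: "\<And>i. v i \<in> D i" "CARD('n) \<le> dim (range v)"
    using rado_transversal[of D] D(2) by blast
  define b where "b i = a i + v i" for i
  have "b i \<in> K i" for i
  proof -
    have "v i \<in> (+) (- a i) ` K i"
      using v(1) D(1) by blast
    then show ?thesis
      by (auto simp: b_def)
  qed
  moreover have "independent_family (\<lambda>i. b i - a i)"
    using independent_family_if_card_le_dim[OF v(2)] by (simp add: b_def)
  ultimately show ?thesis
    unfolding has_independent_segments_def using a by blast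
qed

section \<open>Cayley polytopes\<close>

text \<open>The value of \<open>(u, - c)\<close> at \<open>(x, axis i 1)\<close> is
  \<open>u \<bullet> x - c $ i\<close>: one hyperplane in Cayley space encodes parallel hyperplanes
  with separate offsets, one per body.\<close>

lemma cayley_inner_le:
  assumes "z \<in> cayley P" "\<And>i x. x \<in> P i \<Longrightarrow> u \<bullet> x \<le> c $ i"
  shows "(u, - c) \<bullet> z \<le> 0"
proof -
  have "cayley P \<subseteq> {z. (u, - c) \<bullet> z \<le> 0}"
    unfolding cayley_def using assms(2)
    by (intro hull_minimal convex_halfspace_le) (auto simp: inner_axis)
  then show ?thesis
    using assms(1) by blast
qed

lemma cayley_inner_ge:
  assumes "z \<in> cayley P" "\<And>i x. x \<in> P i \<Longrightarrow> u \<bullet> x \<ge> c $ i"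
  shows "(u, - c) \<bullet> z \<ge> 0"
proof -
  have "cayley P \<subseteq> {z. (u, - c) \<bullet> z \<ge> 0}"
    unfolding cayley_def using assms(2)
    by (intro hull_minimal convex_halfspace_ge) (auto simp: inner_axis)
  then show ?thesis
    using assms(1) by blast
qed

lemma cayley_sum_eq_1:
  assumes "z \<in> cayley P"
  shows "(0, 1) \<bullet> z = 1"
proof -
  have "cayley P \<subseteq> {z. (0, 1) \<bullet> z = 1}"
    unfolding cayley_def
    by (intro hull_minimal convex_hyperplane) (auto simp: inner_axis)
  then show ?thesis
    using assms by blast
qed

lemma in_cayley: "x \<in> P i \<Longrightarrow> (x, axis i 1) \<in> cayley P"
  unfolding cayley_def by (auto intro!: hull_inc)

lemma cayley_mono: "(\<And>i. P i \<subseteq> Q i) \<Longrightarrow> cayley P \<subseteq> cayley Q"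
  unfolding cayley_def by (intro hull_mono) fast

lemma convex_cayley: "convex (cayley P)"
  by (simp add: cayley_def)

lemma compact_cayley: "(\<And>i. compact (P i)) \<Longrightarrow> compact (cayley P)"
  unfolding cayley_def
  by (intro compact_convex_hull compact_UN compact_continuous_image continuous_intros) auto

lemma cayley_slice:
  assumes Q: "\<And>i. compact (Q i)" "\<And>i. convex (Q i)" and x: "(x, axis i 1) \<in> cayley Q"
  shows "x \<in> Q i"
proof (rule ccontr)
  assume "x \<notin> Q i"
  then obtain u b where ub: "u \<bullet> x < b" "\<forall>y\<in>Q i. u \<bullet> y > b"
    using separating_hyperplane_closed_point[of "Q i" x] Q by (auto dest: compact_imp_closed)
  \<comment> \<open>The offset at \<open>i\<close> comes from the separation; elsewhere the support
    function gives an offset valid on all of \<open>Q k\<close>.\<close>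
  define c where "c = (\<chi> k. if k = i then - b else supp_fun (Q k) (- u))"
  have "(- u, - c) \<bullet> (x, axis i (1::real)) \<le> 0"
    using x
  proof (rule cayley_inner_le)
    fix k y assume y: "y \<in> Q k"
    show "- u \<bullet> y \<le> c $ k"
    proof (cases "k = i")
      case True
      then show ?thesis using ub(2) y by (auto simp: c_def intro: less_imp_le)
    next
      case False
      then show ?thesis using inner_le_supp_fun[OF Q(1) y, of "- u"] by (simp add: c_def)
    qed
  qed
  then show False
    using ub(1) by (simp add: inner_axis c_def)
qed

lemma cayley_convex_hull:
  "cayley (\<lambda>i. convex hull (A i)) = convex hull (\<Union>i. (\<lambda>x. (x, axis i 1)) ` A i)"
proof (rule antisym)
  show "cayley (\<lambda>i. convex hull (A i)) \<subseteq> convex hull (\<Union>i. (\<lambda>x. (x, axis i 1)) ` A i)"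
    unfolding cayley_def
  proof (rule hull_minimal, rule UN_least)
    fix i
    have "(\<lambda>x. (x, axis i (1::real))) ` (convex hull (A i)) = (convex hull (A i)) \<times> {axis i 1}"
      by auto
    also have "\<dots> = convex hull (A i \<times> {axis i 1})"
      by (simp add: convex_hull_Times)
    also have "\<dots> \<subseteq> convex hull (\<Union>i. (\<lambda>x. (x, axis i 1)) ` A i)"
      by (intro hull_mono) auto
    finally show "(\<lambda>x. (x, axis i (1::real))) ` (convex hull (A i)) \<subseteq> convex hull (\<Union>i. (\<lambda>x. (x, axis i 1)) ` A i)" .
  qed simp
  show "convex hull (\<Union>i. (\<lambda>x. (x, axis i 1)) ` A i) \<subseteq> cayley (\<lambda>i. convex hull (A i))"
    unfolding cayley_def by (intro hull_mono) (auto intro: hull_inc)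
qed

text \<open>A vector \<open>(u, c)\<close> orthogonal to all of them has \<open>u\<close> orthogonal
  to every direction, so \<open>u = 0\<close> and then \<open>c = 0\<close>. They thus span, and
  their number equals the dimension.\<close>

lemma independent_cayley_vectors:
  fixes a b :: "'n::finite \<Rightarrow> real^'n"
  assumes ind: "independent_family (\<lambda>i. b i - a i)"
  shows "independent (\<Union>i. (\<lambda>x. (x, axis i (1::real))) ` {a i, b i})" (is "independent ?W")
    and "card (\<Union>i. (\<lambda>x. (x, axis i (1::real) :: real^'n)) ` {a i, b i}) = 2 * CARD('n)"
proof -
  have "a i \<noteq> b i" for i
    using independent_family_nonzero[OF ind, of i] by auto
  then show card: "card ?W = 2 * CARD('n)"
    by (subst card_cayley_vectors) auto
  have "span ?W = UNIV"
  proof (rule ccontr)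
    assume "span ?W \<noteq> UNIV"
    then obtain z where z: "z \<noteq> 0" "span ?W \<subseteq> {x. z \<bullet> x = 0}"
      using span_not_univ_subset_hyperplane by blast
    obtain u c where uc: "z = (u, c)"
      by (cases z)
    have *: "u \<bullet> a i + c $ i = 0" "u \<bullet> b i + c $ i = 0" for i
    proof -
      have "(a i, axis i 1) \<in> span ?W" "(b i, axis i 1) \<in> span ?W"
        by (auto intro!: span_base)
      then show "u \<bullet> a i + c $ i = 0" "u \<bullet> b i + c $ i = 0"
        using z(2) by (auto simp: uc inner_axis)
    qed
    then have "u \<bullet> (b i - a i) = 0" for i
      by (metis add_diff_cancel_right diff_self inner_diff_right)
    then have "u = 0"
      by (rule independent_familyD_orthogonal[OF ind])
    with * have "c = 0"
      by (simp add: vec_eq_iff)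
    with \<open>u = 0\<close> z(1) uc show False
      by (simp add: zero_prod_def)
  qed
  then show "independent ?W"
    using card by (intro card_le_dim_spanning[of ?W UNIV]) auto
qed

lemma rel_closure_in_cayley:
  "rel_closure_in (cayley Q) (cayley Q - S) = affine hull (cayley Q) \<inter> closure (cayley Q - S)"
proof -
  have "affine hull (cayley Q) \<inter> (cayley Q - S) = cayley Q - S"
    using hull_subset by fast
  then show ?thesis
    by (simp add: rel_closure_in_def closure_of_subtopology)
qed

text \<open>The hyperplane of \<open>(u, - h)\<close> has \<open>cayley P\<close> on its nonpositive
  side and the simplex over the segments on its nonnegative side.\<close>

lemma caps_imp_cayley_simplex:
  fixes P Q :: "'n::finite \<Rightarrow> (real^'n) set"
  assumes P: "\<And>i. compact (P i)" and Q: "\<And>i. convex (Q i)" and "u \<noteq> 0"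
    and caps: "has_independent_segments (\<lambda>i. {x \<in> Q i. u \<bullet> x \<ge> supp_fun (P i) u})"
  shows "\<exists>E :: 'n \<Rightarrow> (real^'n) set. (\<forall>i. polytope (E i)) \<and> fully_mixed E \<and>
      (2 * int CARD('n) - 1) simplex (cayley E) \<and>
      cayley E \<subseteq> rel_closure_in (cayley Q) (cayley Q - cayley P)"
proof -
  define h where "h = (\<chi> i. supp_fun (P i) u)"
  obtain a b where ab: "\<And>i. a i \<in> Q i" "\<And>i. b i \<in> Q i" "\<And>i. u \<bullet> a i \<ge> h $ i" "\<And>i. u \<bullet> b i \<ge> h $ i"
      and ind: "independent_family (\<lambda>i. b i - a i)"
    using caps unfolding has_independent_segments_def h_def by auto
  define E where "E i = convex hull {a i, b i}" for i
  define W where "W = (\<Union>i. (\<lambda>x. (x, axis i (1::real) :: real^'n)) ` {a i, b i})"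
  have W: "independent W" "card W = 2 * CARD('n)"
    unfolding W_def using independent_cayley_vectors[OF ind] by auto
  have CE: "cayley E = convex hull W"
    unfolding E_def[abs_def] W_def by (rule cayley_convex_hull)
  have "polytope (E i)" for i
    by (simp add: E_def polytope_convex_hull)
  moreover have "fully_mixed E"
    unfolding fully_mixed_def
  proof
    fix i
    have "a i \<noteq> b i"
      using independent_family_nonzero[OF ind, of i] by auto
    then show "1 \<le> aff_dim (E i)"
      by (simp add: E_def aff_dim_convex_hull aff_dim_2)
  qed
  moreover have "(2 * int CARD('n) - 1) simplex (cayley E)"
    unfolding CE using W affine_dependent_imp_dependent by (intro simplex_convex_hull) auto
  moreover have "cayley E \<subseteq> rel_closure_in (cayley Q) (cayley Q - cayley P)"
  proof
    have EQ: "E i \<subseteq> Q i" for i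
      unfolding E_def using ab Q by (intro hull_minimal) auto
    have CEQ: "cayley E \<subseteq> cayley Q"
      using EQ by (rule cayley_mono)
    have nonpos: "(u, - h) \<bullet> z \<le> 0" if "z \<in> cayley P" for z
      using that inner_le_supp_fun[OF P] by (intro cayley_inner_le) (auto simp: h_def)
    have nonneg: "(u, - h) \<bullet> z \<ge> 0" if "z \<in> cayley E" for z
      using that
    proof (rule cayley_inner_ge)
      fix i x assume "x \<in> E i"
      moreover have "E i \<subseteq> {x. u \<bullet> x \<ge> h $ i}"
        unfolding E_def using ab by (intro hull_minimal convex_halfspace_ge) auto
      ultimately show "u \<bullet> x \<ge> h $ i"
        by blast
    qed
    \<comment> \<open>The simplex may touch the hyperplane but not lie in it, since \<open>u\<close>
      is not orthogonal to all directions.\<close>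
    have "\<exists>z\<in>cayley E. (u, - h) \<bullet> z > 0"
    proof (rule ccontr)
      assume "\<not> ?thesis"
      then have zero: "(u, - h) \<bullet> z = 0" if "z \<in> cayley E" for z
        using nonneg[OF that] that by force
      have "u \<bullet> (b i - a i) = 0" for i
      proof -
        have "(a i, axis i 1) \<in> cayley E" "(b i, axis i 1) \<in> cayley E"
          by (auto simp: E_def hull_inc intro!: in_cayley)
        from this[THEN zero] show ?thesis
          by (simp add: inner_axis inner_diff_right)
      qed
      then show False
        using independent_familyD_orthogonal[OF ind] \<open>u \<noteq> 0\<close> by blast
    qed
    then obtain z0 where z0: "z0 \<in> cayley E" "(u, - h) \<bullet> z0 > 0"
      by blast
    have pos: "z \<in> cayley Q - cayley P" if "z \<in> cayley E" "(u, - h) \<bullet> z > 0" for z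
      using that CEQ nonpos[of z] by auto
    fix z assume z: "z \<in> cayley E"
    have "z \<in> closure (cayley Q - cayley P)"
    proof (cases "z = z0")
      case True
      then show ?thesis
        using pos z0 closure_subset by blast
    next
      case False
      \<comment> \<open>Towards \<open>z0\<close> the functional is positive immediately after
        \<open>z\<close>, so \<open>z\<close> is a limit of points outside
        \<open>cayley P\<close>.\<close>
      have "open_segment z z0 \<subseteq> cayley Q - cayley P"
      proof
        fix y assume y: "y \<in> open_segment z z0"
        then obtain t where t: "0 < t" "t < 1" "y = (1 - t) *\<^sub>R z + t *\<^sub>R z0"
          by (auto simp: in_segment)
        have "y \<in> cayley E"
          using convex_cayley[of E] z z0(1) t unfolding convex_alt by auto
        moreover have "(u, - h) \<bullet> y > 0"
        proof -
          have "(u, - h) \<bullet> y = (1 - t) * ((u, - h) \<bullet> z) + t * ((u, - h) \<bullet> z0)"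
            unfolding t(3) by (simp only: inner_add_right inner_scaleR_right)
          then show ?thesis
            using t nonneg[OF z] z0(2) by (simp only:) (intro add_nonneg_pos mult_nonneg_nonneg mult_pos_pos, auto)
        qed
        ultimately show "y \<in> cayley Q - cayley P"
          by (rule pos)
      qed
      then have "closure (open_segment z z0) \<subseteq> closure (cayley Q - cayley P)"
        by (rule closure_mono)
      then show ?thesis
        using False by (auto simp: closure_open_segment)
    qed
    moreover have "z \<in> affine hull (cayley Q)"
      using z CEQ by (auto intro: hull_inc)
    ultimately show "z \<in> rel_closure_in (cayley Q) (cayley Q - cayley P)"
      by (simp add: rel_closure_in_cayley)
  qed
  ultimately show ?thesis
    by blast
qed

section \<open>From Cayley simplices to segments and separating directions\<close>

lemma affinely_independent_in_hyperplane_imp_independent: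
  fixes C :: "'a::euclidean_space set"
  assumes C: "\<not> affine_dependent C" and hyp: "\<And>x. x \<in> C \<Longrightarrow> f \<bullet> x = 1"
  shows "independent C"
proof
  assume dep: "dependent C"
  have fin: "finite C"
    using C by (rule aff_independent_finite)
  obtain w where w: "\<exists>v\<in>C. w v \<noteq> 0" "(\<Sum>v\<in>C. w v *\<^sub>R v) = 0"
    using dep dependent_finite[OF fin] by blast
  \<comment> \<open>Pairing the linear relation with \<open>f\<close> shows that its coefficients
    sum to zero, so it is an affine relation.\<close>
  have "(\<Sum>v\<in>C. w v) = (\<Sum>v\<in>C. w v * (f \<bullet> v))"
    using hyp by simp
  also have "\<dots> = f \<bullet> (\<Sum>v\<in>C. w v *\<^sub>R v)"
    by (simp add: inner_sum_right)
  finally have "(\<Sum>v\<in>C. w v) = 0"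
    using w by simp
  then have "affine_dependent C"
    using w affine_dependent_explicit_finite[OF fin] by blast
  with C show False
    by blast
qed

text \<open>The vertices of the simplex are extreme, hence tagged points of the \<open>E i\<close>.
  Full mixedness gives each tag at least two of the \<open>2 * CARD('n)\<close> vertices, hence
  exactly two.\<close>

lemma fully_mixed_cayley_simplex_imp_independent_segments:
  fixes E :: "'n::finite \<Rightarrow> (real^'n) set"
  assumes mixed: "fully_mixed E"
    and simp: "(2 * int CARD('n) - 1) simplex (cayley E)"
  shows "has_independent_segments E"
proof -
  obtain C where C: "\<not> affine_dependent C" "card C = 2 * CARD('n)" "cayley E = convex hull C"
    using simp unfolding simplex_def by auto
  have CE: "C \<subseteq> (\<Union>i. (\<lambda>x. (x, axis i 1)) ` E i)"
  proof
    fix z assume "z \<in> C"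
    then have "z extreme_point_of (cayley E)"
      using extreme_point_of_convex_hull_affine_independent[OF C(1)] C(3) by simp
    then show "z \<in> (\<Union>i. (\<lambda>x. (x, axis i 1)) ` E i)"
      unfolding cayley_def by (rule extreme_point_of_convex_hull)
  qed
  define A where "A i = {x. (x, axis i 1) \<in> C}" for i
  have fin: "finite C"
    using C(1) by (rule aff_independent_finite)
  have AE: "A i \<subseteq> E i" for i
    using CE by (auto simp: A_def axis_eq_axis)
  have CA: "C = (\<Union>i. (\<lambda>x. (x, axis i 1)) ` A i)"
  proof (intro equalityI subsetI)
    fix z assume z: "z \<in> C"
    then obtain i x where "z = (x, axis i 1)"
      using CE by blast
    with z show "z \<in> (\<Union>i. (\<lambda>x. (x, axis i 1)) ` A i)"
      by (auto simp: A_def)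
  qed (auto simp: A_def)
  have finA: "finite (A i)" for i
    by (rule finite_subset[of _ "fst ` C"]) (use fin in \<open>force simp: A_def\<close>)+
  have ind: "independent (\<Union>i. (\<lambda>x. (x, axis i (1::real))) ` A i)"
    unfolding CA[symmetric] using C(1)
  proof (rule affinely_independent_in_hyperplane_imp_independent)
    fix z assume "z \<in> C"
    then have "z \<in> cayley E"
      using C(3) by (simp add: hull_inc)
    then show "(0, 1) \<bullet> z = 1"
      by (rule cayley_sum_eq_1)
  qed
  have "cayley E = cayley (\<lambda>i. convex hull (A i))"
    unfolding C(3) cayley_convex_hull CA[symmetric] ..
  \<comment> \<open>Slicing recovers \<open>E i\<close> inside the hull of \<open>A i\<close>, so
    \<open>A i\<close> inherits positive dimension.\<close>
  then have "E i \<subseteq> convex hull (A i)" for i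
    using finA in_cayley[of _ E i]
    by (auto intro!: cayley_slice[of "\<lambda>i. convex hull (A i)"] finite_imp_compact_convex_hull)
  then have "aff_dim (E i) \<le> aff_dim (A i)" for i
    using aff_dim_subset[of "E i" "convex hull (A i)"] by (simp add: aff_dim_convex_hull)
  then have one: "1 \<le> aff_dim (A i)" for i
    using mixed unfolding fully_mixed_def by (meson order_trans)
  have ge: "2 \<le> card (A i)" for i
    using one[of i] aff_dim_le_card[OF finA, of i] by simp
  have le: "(\<Sum>i\<in>UNIV. card (A i)) \<le> 2 * CARD('n)"
    using C(2) unfolding CA by (subst (asm) card_cayley_vectors) (use finA in auto)
  obtain a b where ab: "\<And>i. A i = {a i, b i}" "\<And>i. a i \<noteq> b i"
    using family_of_pairs[OF ge le] by blast
  then have "independent_family (\<lambda>i. b i - a i)"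
    using ind unfolding ab(1) by (intro independent_cayley_vectors_imp_independent_family)
  then show ?thesis
    unfolding has_independent_segments_def using AE ab(1) by (metis insertI1 insert_commute subsetD)
qed

lemma in_affine_hull_if_span_UNIV:
  fixes S :: "'a::euclidean_space set"
  assumes "span S = UNIV" "\<And>x. x \<in> S \<Longrightarrow> f \<bullet> x = 1" "f \<bullet> z = 1"
  shows "z \<in> affine hull S"
proof -
  have "z \<in> span S"
    using assms(1) by simp
  then obtain t r where t: "finite t" "t \<subseteq> S" "z = (\<Sum>v\<in>t. r v *\<^sub>R v)"
    unfolding span_explicit by blast
  have "f \<bullet> z = (\<Sum>v\<in>t. r v * (f \<bullet> v))"
    by (simp add: t inner_sum_right)
  also have "\<dots> = (\<Sum>v\<in>t. r v)"
    using assms(2) t(2) by (intro sum.cong) auto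
  finally have "(\<Sum>v\<in>t. r v) = 1"
    using assms(3) by simp
  then have "z \<in> affine hull t"
    unfolding affine_hull_finite[OF t(1)] using t(3) by blast
  then show ?thesis
    using hull_mono[OF t(2)] by blast
qed

text \<open>Fullness puts \<open>cayley Q - cayley P\<close> into the affine hull of
  \<open>cayley P\<close>, whose relative interior therefore contains no limit of such points and
  can be separated from \<open>cayley E\<close>.\<close>

lemma cayley_separation:
  fixes P Q E :: "'n::finite \<Rightarrow> (real^'n) set"
  assumes ne: "\<And>i. P i \<noteq> {}" "\<And>i. E i \<noteq> {}"
    and full: "span (cayley P) = UNIV"
    and sub: "cayley E \<subseteq> closure (cayley Q - cayley P)"
  obtains u where "u \<noteq> 0" "\<And>i x y. x \<in> P i \<Longrightarrow> y \<in> E i \<Longrightarrow> u \<bullet> x \<le> u \<bullet> y"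
proof -
  define R where "R = rel_interior (cayley P)"
  have neC: "cayley P \<noteq> {}" "cayley E \<noteq> {}"
    using ne in_cayley by fast+
  have R: "R \<noteq> {}" "convex R" "closure R = closure (cayley P)" "R \<subseteq> cayley P"
    using neC convex_cayley[of P]
    by (auto simp: R_def rel_interior_eq_empty convex_rel_interior convex_closure_rel_interior
        dest: rel_interior_subset[THEN subsetD])
  have "R \<inter> cayley E = {}"
  proof (rule ccontr)
    assume "R \<inter> cayley E \<noteq> {}"
    then obtain z where z: "z \<in> R" "z \<in> cayley E"
      by blast
    then obtain e where e: "e > 0" "ball z e \<inter> affine hull (cayley P) \<subseteq> cayley P"
      by (auto simp: R_def mem_rel_interior_ball)
    obtain y where y: "y \<in> cayley Q - cayley P" "dist y z < e"
      using sub z(2) e(1) by (meson closure_approachable subsetD)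
    have "y \<in> affine hull (cayley P)"
      using full y(1) by (intro in_affine_hull_if_span_UNIV[where f = "(0, 1)"]) (auto intro: cayley_sum_eq_1)
    then have "y \<in> ball z e \<inter> affine hull (cayley P)"
      using y(2) by (simp add: dist_commute)
    then show False
      using e(2) y(1) by blast
  qed
  define D where "D = (\<Union>x\<in>cayley E. \<Union>y\<in>R. {x - y})"
  have "convex D" "D \<noteq> {}" "0 \<notin> D"
    using R neC \<open>R \<inter> cayley E = {}\<close> by (auto simp: D_def intro!: convex_differences convex_cayley)
  \<comment> \<open>Taking \<open>g\<close> in the affine hull of the differences excludes multiples
    of \<open>(0, 1)\<close>, for which \<open>u\<close> would vanish.\<close>
  then obtain g k where g: "0 + g \<in> affine hull (insert 0 D)" "g \<noteq> 0" "g \<bullet> 0 \<le> k" "\<And>x. x \<in> D \<Longrightarrow> g \<bullet> x \<ge> k"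
    by (rule separating_hyperplane_set_point_inaff) (use that in blast)
  have "g \<bullet> x \<le> g \<bullet> y" if "x \<in> cayley P" "y \<in> cayley E" for x y
  proof -
    have "R \<subseteq> {x. g \<bullet> x \<le> g \<bullet> y}"
    proof
      fix r assume "r \<in> R"
      then have "y - r \<in> D" using that by (auto simp: D_def)
      from g(4)[OF this] show "r \<in> {x. g \<bullet> x \<le> g \<bullet> y}"
        using g(3) by (simp add: inner_diff_right)
    qed
    then have "closure R \<subseteq> {x. g \<bullet> x \<le> g \<bullet> y}"
      by (intro closure_minimal closed_halfspace_le)
    then show ?thesis
      using that(1) R(3) closure_subset by blast
  qed
  moreover obtain u c where uc: "g = (u, c)"
    by (cases g)
  ultimately have le: "u \<bullet> x + c $ i \<le> u \<bullet> y + c $ j" if "x \<in> P i" "y \<in> E j" for x y i j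
    using in_cayley[of x P i] in_cayley[of y E j] that by (force simp: inner_axis)
  have "u \<noteq> 0"
  proof
    assume "u = 0"
    \<comment> \<open>For \<open>u = 0\<close> only the tags are compared, so all entries of
      \<open>c\<close> agree; the choice of \<open>g\<close> makes them sum to zero.\<close>
    have "c $ i \<le> c $ j" for i j
      using le[of _ i _ j] ne(1)[of i] ne(2)[of j] \<open>u = 0\<close> by force
    then have c: "c $ i = c $ j" for i j
      by (meson antisym)
    have "(0, 1) \<bullet> z = 0" if z: "z \<in> D" for z
    proof -
      obtain x y where "x \<in> cayley E" "y \<in> cayley P" "z = x - y"
        using z R(4) unfolding D_def by blast
      then show ?thesis
        using cayley_sum_eq_1[of x E] cayley_sum_eq_1[of y P] by (simp only: inner_diff_right)
    qed
    then have "insert 0 D \<subseteq> {z. (0, 1) \<bullet> z = 0}"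
      by auto
    then have "affine hull (insert 0 D) \<subseteq> {z. (0, 1) \<bullet> z = 0}"
      by (intro hull_minimal affine_hyperplane)
    then have "(0, 1) \<bullet> g = 0"
      using g(1) by auto
    then have "(\<Sum>i\<in>UNIV. c $ i) = 0"
      by (simp add: uc inner_vec_def)
    moreover have "(\<Sum>i\<in>UNIV. c $ i) = real CARD('n) * c $ j" for j
      using sum.cong[of UNIV UNIV "\<lambda>i. c $ i" "\<lambda>_. c $ j"] c by simp
    ultimately have "c = 0"
      by (simp add: vec_eq_iff)
    with \<open>u = 0\<close> uc g(2) show False
      by (simp add: zero_prod_def)
  qed
  moreover have "u \<bullet> x \<le> u \<bullet> y" if "x \<in> P i" "y \<in> E i" for i x y
    using le[OF that] by simp
  ultimately show ?thesis
    using that by blast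
qed

theorem theorem4p4:
  fixes P Q :: "'n::finite \<Rightarrow> (real^'n) set"
  assumes "\<And>i. polytope (P i)" and "\<And>i. polytope (Q i)"
    and "\<And>i. P i \<noteq> {}"
    and "\<And>i. P i \<subseteq> Q i"
  defines "B \<equiv> (\<lambda>u i. {x \<in> Q i. inner u x \<ge> supp_fun (P i) u})"
  shows "((mixed_volume P < mixed_volume Q)
           \<longleftrightarrow> (\<exists>E :: 'n \<Rightarrow> (real^'n) set.
                  (\<forall>i. polytope (E i)) \<and> fully_mixed E \<and>
                  (2 * int CARD('n) - 1) simplex (cayley E) \<and>
                  cayley E \<subseteq> rel_closure_in (cayley Q) (cayley Q - cayley P)))
       \<and> ((mixed_volume P < mixed_volume Q)
           \<longleftrightarrow> (\<exists>u. u \<noteq> 0 \<and> essential (B u)))"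
proof -
  have Pc: "compact (P i)" and Qc: "compact (Q i)" "convex (Q i)" for i
    using assms(1,2) by (auto simp: polytope_imp_compact polytope_imp_convex)
  have Bne: "B u i \<noteq> {}" for u i
    unfolding B_def using Pc assms(3,4) by (rule cap_nonempty)
  have Bp: "polytope (B u i)" for u i
    unfolding B_def using assms(2) by (rule polytope_cap)
  have ess: "essential (B u) \<longleftrightarrow> has_independent_segments (B u)" for u
    using essential_imp_has_independent_segments[of "B u"] has_independent_segments_imp_essential[of "B u"] Bne
    by blast
  have less_if_caps: "mixed_volume P < mixed_volume Q" if "u \<noteq> 0" "has_independent_segments (B u)" for u
    using mixed_volume_superadditive_caps[of P Q u, OF assms(1-4) that(1)]
      mixed_volume_pos_if_independent_segments[OF Bp that(2)]
    by (simp add: B_def)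
  have caps_if_less: "\<exists>u. u \<noteq> 0 \<and> has_independent_segments (B u)" if "mixed_volume P < mixed_volume Q"
    unfolding B_def using mixed_volume_less_imp_caps[of P Q, OF assms(1-4) that] .
  have "mixed_volume P < mixed_volume Q"
    if E: "\<forall>i. polytope (E i)" "fully_mixed E" "(2 * int CARD('n) - 1) simplex (cayley E)"
      "cayley E \<subseteq> rel_closure_in (cayley Q) (cayley Q - cayley P)" for E
  proof -
    have seg: "has_independent_segments E"
      using E by (intro fully_mixed_cayley_simplex_imp_independent_segments)
    have Ene: "E i \<noteq> {}" for i
      using seg unfolding has_independent_segments_def by blast
    have sub: "cayley E \<subseteq> closure (cayley Q - cayley P)"
      using E(4) by (simp add: rel_closure_in_cayley)
    \<comment> \<open>\<open>cayley Q\<close> is closed, so passing to the closure does not leave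
      it.\<close>
    also have "\<dots> \<subseteq> cayley Q"
      using compact_cayley[OF Qc(1)] by (intro closure_minimal compact_imp_closed) auto
    finally have EQ: "E i \<subseteq> Q i" for i
      using in_cayley[of _ E i] Qc by (auto intro!: cayley_slice[of Q])
    txt \<open>A degenerate Cayley polytope of \<open>P\<close> need not be separable from that of \<open>E\<close>, but then
      \<open>mixed_volume P = 0\<close>.\<close>
    show ?thesis
    proof (cases "span (cayley P) = UNIV")
      case True
      obtain u where u: "u \<noteq> 0" "\<And>i x y. x \<in> P i \<Longrightarrow> y \<in> E i \<Longrightarrow> u \<bullet> x \<le> u \<bullet> y"
        using cayley_separation[OF assms(3) Ene True sub] by blast
      have "E i \<subseteq> B u i" for i
        using EQ[of i] u(2)[of _ i] supp_fun_le[OF assms(3)[of i], of u] by (auto simp: B_def)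
      with seg have "has_independent_segments (B u)"
        by (rule has_independent_segments_mono)
      with u(1) show ?thesis
        by (rule less_if_caps)
    next
      case False
      then obtain z where z: "z \<noteq> 0" "span (cayley P) \<subseteq> {x. z \<bullet> x = 0}"
        using span_not_univ_subset_hyperplane by blast
      obtain u c where uc: "z = (u, c)"
        by (cases z)
      \<comment> \<open>\<open>z\<close> annihilates every tagged point, so each \<open>P i\<close>
        lies in a hyperplane with the common normal \<open>u\<close>.\<close>
      have *: "u \<bullet> x = - (c $ i)" if "x \<in> P i" for x i
        using span_base[OF in_cayley[of x P i, OF that]] z(2) by (force simp: uc inner_axis)
      have "u \<noteq> 0"
      proof
        assume "u = 0"
        then have "c = 0"
          using * assms(3) by (force simp: vec_eq_iff)
        with \<open>u = 0\<close> z(1) uc show False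
          by (simp add: zero_prod_def)
      qed
      then have "mixed_volume P = 0"
        using * by (rule mixed_volume_eq_0_if_parallel_hyperplanes)
      also have "0 < mixed_volume E"
        using E(1) seg by (intro mixed_volume_pos_if_independent_segments) auto
      also have "\<dots> \<le> mixed_volume Q"
        using E(1) assms(2) Ene EQ by (intro mixed_volume_mono) auto
      finally show ?thesis .
    qed
  qed
  moreover have "\<exists>E :: 'n \<Rightarrow> (real^'n) set. (\<forall>i. polytope (E i)) \<and> fully_mixed E \<and>
      (2 * int CARD('n) - 1) simplex (cayley E) \<and>
      cayley E \<subseteq> rel_closure_in (cayley Q) (cayley Q - cayley P)"
    if less: "mixed_volume P < mixed_volume Q"
  proof -
    obtain u where u: "u \<noteq> 0" "has_independent_segments (B u)"
      using caps_if_less[OF less] by blast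
    show ?thesis
      using caps_imp_cayley_simplex[of P Q u, OF Pc Qc(2) u(1)] u(2) by (simp add: B_def)
  qed
  ultimately show ?thesis
    using less_if_caps caps_if_less ess by blast
qed

end
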